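(* Let $\mathbb{K}$ be a field and let $d,n\ge 2$ be integers. Let $\mathcal{M}_{n,d}$ be the set of all monomials of degree $d$ in $\mathbb{K}[x_0,\dots,x_n]$, and let $\Omega_{n,d}\subseteq \mathcal{M}_{n,d}$ be any subset such that $$\Omega_{n,d}\supseteq\Big\{m\in\mathcal{M}_{n,d}\ \Big|\ |\operatorname{supp}(m)|\le \Big\lceil \tfrac{n+2}{2}\Big\rceil\Big\}.$$ Then the monomial algebra $\mathbb{K}[\Omega_{n,d}]$ (the homogeneous coordinate ring of the monomial projection $Y_{n,d}$ parameterized by $\Omega_{n,d}$) is quadratic. In particular, for every integer $s\ge\lceil \frac{n+2}{2}\rceil$ the pinched Veronese algebra $\mathrm{PV}(n,d,s)$ is quadratic.
   Context: For a monomial $m=x_0^{a_0}\cdots x_n^{a_n}$, $\operatorname{supp}(m)=\{x_i\mid a_i>0\}$. For a set $\Omega=\{m_1,\dots,m_\mu\}$ of monomials of degree $d$ in $R=\mathbb{K}[x_0,\dots,x_n]$, $\mathbb{K}[\Omega]\subseteq R$ is the $\mathbb{K}$-subalgebra generated by $\Omega$, graded so that each $m_i$ has degree 1. Its defining ideal is the kernel $\mathrm{I}(Y_{n,d})$ of the $\mathbb{K}$-algebra homomorphism $\rho:S=\mathbb{K}[w_1,\dots,w_\mu]\to R$, $w_i\mapsto m_i$, where $S$ is standard graded; this is the homogeneous ideal of the projective variety $Y_{n,d}\subset\mathbb{P}^{\mu-1}$ which is the closure of the image of the rational map $\mathbb{P}^n\dashrightarrow\mathbb{P}^{\mu-1}$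 given by $\Omega$. The algebra $\mathbb{K}[\Omega]\cong S/\mathrm{I}(Y_{n,d})$ is called quadratic if $\mathrm{I}(Y_{n,d})$ is generated by homogeneous polynomials of degree 2. The pinched Veronese algebra $\mathrm{PV}(n,d,s)$ is the $\mathbb{K}$-subalgebra of $R$ generated by all monomials $m$ of degree $d$ with $|\operatorname{supp}(m)|\le s$. *)

theory Defs
  imports
    "HOL-Library.Poly_Mapping"
    "HOL-Algebra.Ideal"
    "HOL-Algebra.RingHom"
    "HOL-Algebra.Generated_Rings"
begin

section \<open>Monomials and polynomial rings\<close>

text \<open>
  A monomial in variables of type \<open>'x\<close> is identified with its exponent vector, a finitely
  supported function \<open>'x \<Rightarrow>\<^sub>0 nat\<close>; its support is \<^term>\<open>Poly_Mapping.keys\<close>. A polynomial over \<open>'k\<close>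
  is a finitely supported function from monomials to coefficients, so that the ring operations
  of \<open>('x \<Rightarrow>\<^sub>0 nat) \<Rightarrow>\<^sub>0 'k\<close> are those of polynomials, and the monomial \<open>u\<close>, viewed as a
  polynomial, is \<open>Poly_Mapping.single u 1\<close>.
\<close>

type_synonym 'x monomial = "'x \<Rightarrow>\<^sub>0 nat"
type_synonym ('x, 'k) mpoly = "('x \<Rightarrow>\<^sub>0 nat) \<Rightarrow>\<^sub>0 'k"

definition mon_degree :: "'x monomial \<Rightarrow> nat" where
  "mon_degree u = (\<Sum>x\<in>Poly_Mapping.keys u. Poly_Mapping.lookup u x)"

text \<open>The polynomial ring in the variables \<open>X\<close>.\<close>

definition poly_ring :: "'x set \<Rightarrow> ('x, 'k::comm_ring_1) mpoly ring" where
  "poly_ring X =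
    \<lparr>carrier = {p. \<forall>u\<in>Poly_Mapping.keys p. Poly_Mapping.keys u \<subseteq> X},
     mult = (*), one = 1, zero = 0, add = (+)\<rparr>"

definition homogeneous :: "nat \<Rightarrow> ('x, 'k::zero) mpoly \<Rightarrow> bool" where
  "homogeneous e p \<longleftrightarrow> (\<forall>u\<in>Poly_Mapping.keys p. mon_degree u = e)"

text \<open>The monomials of degree \<open>d\<close> in \<open>x\<^sub>0, \<dots>, x\<^sub>n\<close>.\<close>

definition monomials :: "nat \<Rightarrow> nat \<Rightarrow> nat monomial set" where
  "monomials n d = {m. Poly_Mapping.keys m \<subseteq> {0..n} \<and> mon_degree m = d}"


section \<open>Monomial algebras and their defining ideals\<close>

definition monomial_algebra :: "nat \<Rightarrow> nat monomial set \<Rightarrow> (nat, 'k::field) mpoly set" where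
  "monomial_algebra n \<Omega> =
    generate_ring (poly_ring {0..n})
      (range (Poly_Mapping.single 0) \<union> (\<lambda>m. Poly_Mapping.single m 1) ` \<Omega>)"

text \<open>
  The presentation ring has one variable \<open>w\<^sub>m\<close> for each \<open>m \<in> \<Omega>\<close>, and the variables are named by
  the monomials themselves. So a monomial \<open>u\<close> of the presentation ring is an exponent vector
  indexed by monomials, and \<open>\<rho>\<close> substitutes \<open>m\<close> for \<open>w\<^sub>m\<close>.
\<close>

definition \<rho> :: "(nat monomial, 'k::field) mpoly \<Rightarrow> (nat, 'k) mpoly" where
  "\<rho> p = (\<Sum>u\<in>Poly_Mapping.keys p.
      Poly_Mapping.single 0 (Poly_Mapping.lookup p u) *
      (\<Prod>m\<in>Poly_Mapping.keys u. Poly_Mapping.single m 1 ^ Poly_Mapping.lookup u m))"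

definition defining_ideal :: "nat \<Rightarrow> nat monomial set \<Rightarrow> (nat monomial, 'k::field) mpoly set" where
  "defining_ideal n \<Omega> = a_kernel (poly_ring \<Omega>) (poly_ring {0..n}) \<rho>"

definition generated_by_quadrics :: "'x set \<Rightarrow> ('x, 'k::field) mpoly set \<Rightarrow> bool" where
  "generated_by_quadrics X I \<longleftrightarrow>
    (\<exists>G. G \<subseteq> carrier (poly_ring X) \<and> (\<forall>g\<in>G. homogeneous 2 g) \<and> I = Idl\<^bsub>poly_ring X\<^esub> G)"

text \<open>
  \<open>A\<close> is a quadratic monomial algebra, with generators in degree \<open>d\<close>. The set \<open>\<Omega>\<close> is determined
  by \<open>A\<close> as soon as \<open>d > 0\<close>, so the existential quantifier involves no choice of
  presentation: see \<open>monomial_algebra_inject\<close> and \<open>quadratic_monomial_algebra_iff\<close> below.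
\<close>

definition quadratic_algebra :: "nat \<Rightarrow> nat \<Rightarrow> (nat, 'k::field) mpoly set \<Rightarrow> bool" where
  "quadratic_algebra n d A \<longleftrightarrow>
    (\<exists>\<Omega>\<subseteq>monomials n d. A = monomial_algebra n \<Omega> \<and>
      generated_by_quadrics \<Omega> (defining_ideal n \<Omega> :: (nat monomial, 'k) mpoly set))"

definition PV :: "nat \<Rightarrow> nat \<Rightarrow> nat \<Rightarrow> (nat, 'k::field) mpoly set" where
  "PV n d s = monomial_algebra n {m \<in> monomials n d. card (Poly_Mapping.keys m) \<le> s}"


section \<open>Consistency of the definitions\<close>

lemma poly_ring_simps [simp]:
  "carrier (poly_ring X) = {p. \<forall>u\<in>Poly_Mapping.keys p. Poly_Mapping.keys u \<subseteq> X}"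
  "mult (poly_ring X) = (*)" "one (poly_ring X) = 1"
  "zero (poly_ring X) = 0" "add (poly_ring X) = (+)"
  by (simp_all add: poly_ring_def)

lemma keys_exponent_add:
  fixes u v :: "'x monomial"
  shows "Poly_Mapping.keys (u + v) = Poly_Mapping.keys u \<union> Poly_Mapping.keys v"
  by (auto simp: in_keys_iff lookup_add)

lemma mon_degree_superset:
  assumes "finite F" "Poly_Mapping.keys u \<subseteq> F"
  shows "mon_degree u = (\<Sum>x\<in>F. Poly_Mapping.lookup u x)"
  unfolding mon_degree_def using assms
  by (intro sum.mono_neutral_left) (auto simp: in_keys_iff)

lemma mon_degree_add: "mon_degree (u + v) = mon_degree u + mon_degree v"
proof -
  let ?F = "Poly_Mapping.keys u \<union> Poly_Mapping.keys v"
  have "mon_degree (u + v) = (\<Sum>x\<in>?F. Poly_Mapping.lookup (u + v) x)"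
    by (rule mon_degree_superset) (auto simp: keys_exponent_add)
  also have "\<dots> = (\<Sum>x\<in>?F. Poly_Mapping.lookup u x) + (\<Sum>x\<in>?F. Poly_Mapping.lookup v x)"
    by (simp add: lookup_add sum.distrib)
  also have "\<dots> = mon_degree u + mon_degree v"
    by (subst (1 2) mon_degree_superset[where F = ?F]) auto
  finally show ?thesis .
qed

lemma poly_ring_mult_closed:
  fixes p q :: "('x, 'k::comm_ring_1) mpoly"
  assumes "p \<in> carrier (poly_ring X)" "q \<in> carrier (poly_ring X)"
  shows "p * q \<in> carrier (poly_ring X)"
  using assms keys_mult[of p q] by (fastforce simp: keys_exponent_add)

lemma poly_ring_add_closed:
  fixes p q :: "('x, 'k::comm_ring_1) mpoly"
  assumes "p \<in> carrier (poly_ring X)" "q \<in> carrier (poly_ring X)"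
  shows "p + q \<in> carrier (poly_ring X)"
  using assms Poly_Mapping.keys_add[of p q] by fastforce

lemma keys_uminus_mpoly:
  fixes p :: "('x, 'k::comm_ring_1) mpoly"
  shows "Poly_Mapping.keys (- p) = Poly_Mapping.keys p"
  by (auto simp: in_keys_iff)

lemma poly_ring_cring: "cring (poly_ring X :: ('x, 'k::comm_ring_1) mpoly ring)"
proof (rule cringI)
  show "abelian_group (poly_ring X :: ('x, 'k) mpoly ring)"
  proof (rule abelian_groupI)
    fix p :: "('x, 'k) mpoly"
    assume "p \<in> carrier (poly_ring X)"
    then have "- p \<in> carrier (poly_ring X)"
      by (simp add: keys_uminus_mpoly)
    then show "\<exists>q\<in>carrier (poly_ring X). q \<oplus>\<^bsub>poly_ring X\<^esub> p = \<zero>\<^bsub>poly_ring X\<^esub>"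
      by (intro bexI[of _ "- p"]) auto
  next
    fix p q :: "('x, 'k) mpoly"
    assume "p \<in> carrier (poly_ring X)" "q \<in> carrier (poly_ring X)"
    then show "p \<oplus>\<^bsub>poly_ring X\<^esub> q \<in> carrier (poly_ring X)"
      using poly_ring_add_closed[of p X q] by simp
  qed (auto simp: algebra_simps)
  show "comm_monoid (poly_ring X :: ('x, 'k) mpoly ring)"
  proof (rule comm_monoidI)
    fix p q :: "('x, 'k) mpoly"
    assume "p \<in> carrier (poly_ring X)" "q \<in> carrier (poly_ring X)"
    then show "p \<otimes>\<^bsub>poly_ring X\<^esub> q \<in> carrier (poly_ring X)"
      using poly_ring_mult_closed[of p X q] by simp
  qed (auto simp: algebra_simps)
qed (auto simp: algebra_simps)

lemma a_inv_poly_ring: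
  fixes p :: "('x, 'k::comm_ring_1) mpoly"
  assumes "p \<in> carrier (poly_ring X)"
  shows "\<ominus>\<^bsub>poly_ring X\<^esub> p = - p"
proof -
  interpret cring "poly_ring X :: ('x, 'k) mpoly ring" by (rule poly_ring_cring)
  show ?thesis
    by (rule minus_equality) (use assms in \<open>auto simp: keys_uminus_mpoly\<close>)
qed

lemma monomial_generators_closed:
  assumes "\<Omega> \<subseteq> monomials n d"
  shows "range (Poly_Mapping.single 0) \<union> (\<lambda>m. Poly_Mapping.single m 1) ` \<Omega>
    \<subseteq> carrier (poly_ring {0..n} :: (nat, 'k::field) mpoly ring)"
  using assms by (auto simp: monomials_def split: if_splits)

definition subst_monomial :: "nat monomial monomial \<Rightarrow> (nat, 'k::field) mpoly" where
  "subst_monomial u =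
    (\<Prod>m\<in>Poly_Mapping.keys u. Poly_Mapping.single m 1 ^ Poly_Mapping.lookup u m)"

lemma subst_monomial_superset:
  assumes "finite F" "Poly_Mapping.keys u \<subseteq> F"
  shows "subst_monomial u = (\<Prod>m\<in>F. Poly_Mapping.single m 1 ^ Poly_Mapping.lookup u m)"
  unfolding subst_monomial_def using assms
  by (intro prod.mono_neutral_left) (auto simp: in_keys_iff)

lemma subst_monomial_add:
  "subst_monomial (u + v) = subst_monomial u * subst_monomial v"
proof -
  let ?F = "Poly_Mapping.keys u \<union> Poly_Mapping.keys v"
  have "subst_monomial (u + v) =
      (\<Prod>m\<in>?F. Poly_Mapping.single m 1 ^ Poly_Mapping.lookup (u + v) m :: (nat, 'a) mpoly)"
    by (rule subst_monomial_superset) (auto simp: keys_exponent_add)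
  also have "\<dots> = (\<Prod>m\<in>?F. Poly_Mapping.single m 1 ^ Poly_Mapping.lookup u m) *
      (\<Prod>m\<in>?F. Poly_Mapping.single m 1 ^ Poly_Mapping.lookup v m)"
    by (simp add: lookup_add power_add prod.distrib)
  also have "\<dots> = subst_monomial u * subst_monomial v"
    by (subst (1 2) subst_monomial_superset[where F = ?F]) auto
  finally show ?thesis .
qed

lemma rho_superset:
  assumes "finite F" "Poly_Mapping.keys p \<subseteq> F"
  shows "\<rho> p = (\<Sum>u\<in>F. Poly_Mapping.single 0 (Poly_Mapping.lookup p u) * subst_monomial u)"
  unfolding \<rho>_def subst_monomial_def using assms
  by (intro sum.mono_neutral_left) (auto simp: in_keys_iff)

lemma rho_add: "\<rho> (p + q) = \<rho> p + \<rho> q"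
proof -
  let ?F = "Poly_Mapping.keys p \<union> Poly_Mapping.keys q"
  have "\<rho> (p + q) =
      (\<Sum>u\<in>?F. Poly_Mapping.single 0 (Poly_Mapping.lookup (p + q) u) * subst_monomial u)"
    by (rule rho_superset) (simp_all add: Poly_Mapping.keys_add)
  also have "\<dots> = (\<Sum>u\<in>?F. Poly_Mapping.single 0 (Poly_Mapping.lookup p u) * subst_monomial u) +
      (\<Sum>u\<in>?F. Poly_Mapping.single 0 (Poly_Mapping.lookup q u) * subst_monomial u)"
    by (simp add: lookup_add single_add distrib_right sum.distrib)
  also have "\<dots> = \<rho> p + \<rho> q"
    by (subst (1 2) rho_superset[where F = ?F]) auto
  finally show ?thesis .
qed

lemma rho_sum: "\<rho> (sum f F) = (\<Sum>i\<in>F. \<rho> (f i))"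
proof (induction F rule: infinite_finite_induct)
  case (insert i F)
  then show ?case by (simp add: rho_add)
qed (simp_all add: \<rho>_def)

lemma rho_single:
  "\<rho> (Poly_Mapping.single u c) = Poly_Mapping.single 0 c * subst_monomial u"
  by (subst rho_superset[where F = "{u}"]) (auto split: if_splits)

lemma mpoly_sum_single:
  fixes p :: "('x, 'k::comm_ring_1) mpoly"
  shows "p = (\<Sum>u\<in>Poly_Mapping.keys p. Poly_Mapping.single u (Poly_Mapping.lookup p u))"
  by (rule poly_mapping_eqI)
    (simp add: lookup_sum lookup_single when_def in_keys_iff)

lemma single_0_mult:
  fixes a b :: "'k::comm_ring_1"
  shows "(Poly_Mapping.single 0 (a * b) :: ('x, 'k) mpoly) =
    Poly_Mapping.single 0 a * Poly_Mapping.single 0 b"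
  by (simp add: mult_single)

lemma rho_mult: "\<rho> (p * q) = \<rho> p * \<rho> q"
proof -
  let ?P = "Poly_Mapping.keys p" and ?Q = "Poly_Mapping.keys q"
  have "p * q = (\<Sum>u\<in>?P. \<Sum>v\<in>?Q.
      Poly_Mapping.single (u + v) (Poly_Mapping.lookup p u * Poly_Mapping.lookup q v))"
    by (subst mpoly_sum_single[of p], subst mpoly_sum_single[of q])
      (simp add: sum_product mult_single)
  then have "\<rho> (p * q) = (\<Sum>u\<in>?P. \<Sum>v\<in>?Q.
      \<rho> (Poly_Mapping.single u (Poly_Mapping.lookup p u)) *
      \<rho> (Poly_Mapping.single v (Poly_Mapping.lookup q v)))"
    by (simp add: rho_sum rho_single subst_monomial_add single_0_mult ac_simps)
  also have "\<dots> = (\<Sum>u\<in>?P. \<rho> (Poly_Mapping.single u (Poly_Mapping.lookup p u))) *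
      (\<Sum>v\<in>?Q. \<rho> (Poly_Mapping.single v (Poly_Mapping.lookup q v)))"
    by (simp add: sum_product)
  also have "\<dots> = \<rho> p * \<rho> q"
    by (simp only: rho_sum[symmetric] mpoly_sum_single[symmetric])
  finally show ?thesis .
qed

lemma rho_const: "\<rho> (Poly_Mapping.single 0 c) = Poly_Mapping.single 0 c"
  by (simp add: rho_single subst_monomial_def)

lemma rho_var:
  "\<rho> (Poly_Mapping.single (Poly_Mapping.single m 1) 1) = Poly_Mapping.single m 1"
  by (simp add: rho_single subst_monomial_def)

lemma rho_closed:
  assumes "\<Omega> \<subseteq> monomials n d" "p \<in> carrier (poly_ring \<Omega>)"
  shows "\<rho> p \<in> carrier (poly_ring {0..n} :: (nat, 'k::field) mpoly ring)"
proof -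
  let ?R = "carrier (poly_ring {0..n} :: (nat, 'k) mpoly ring)"
  have zero: "0 \<in> ?R" and one: "1 \<in> ?R" by auto
  have sum: "sum f F \<in> ?R" if "\<And>i. i \<in> F \<Longrightarrow> f i \<in> ?R" for f :: "'i \<Rightarrow> _" and F
    using that
    by (induction F rule: infinite_finite_induct)
      (simp_all add: zero poly_ring_add_closed del: poly_ring_simps(1))
  have prod: "prod f F \<in> ?R" if "\<And>i. i \<in> F \<Longrightarrow> f i \<in> ?R" for f :: "'i \<Rightarrow> _" and F
    using that
    by (induction F rule: infinite_finite_induct)
      (simp_all add: one poly_ring_mult_closed del: poly_ring_simps(1))
  have pow: "q ^ k \<in> ?R" if "q \<in> ?R" for q k
    using that
    by (induction k) (simp_all add: one poly_ring_mult_closed del: poly_ring_simps(1))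
  show ?thesis
    unfolding \<rho>_def
  proof (intro sum poly_ring_mult_closed prod pow)
    fix u m assume "u \<in> Poly_Mapping.keys p" "m \<in> Poly_Mapping.keys u"
    with assms have "m \<in> monomials n d" by auto
    then show "Poly_Mapping.single m 1 \<in> ?R" by (auto simp: monomials_def)
  qed (auto split: if_splits)
qed

lemma rho_ring_hom:
  assumes "\<Omega> \<subseteq> monomials n d"
  shows "\<rho> \<in> ring_hom (poly_ring \<Omega> :: (nat monomial, 'k::field) mpoly ring) (poly_ring {0..n})"
proof (rule ring_hom_memI)
  show "\<rho> p \<in> carrier (poly_ring {0..n})"
    if "p \<in> carrier (poly_ring \<Omega> :: (nat monomial, 'k) mpoly ring)" for p
    using rho_closed[OF assms that] .
qed (use rho_const[of 1] in \<open>auto simp: rho_mult rho_add\<close>)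

lemma keys_monomial_algebra:
  assumes \<Omega>: "\<Omega> \<subseteq> monomials n d"
    and p: "p \<in> (monomial_algebra n \<Omega> :: (nat, 'k::field) mpoly set)"
    and u: "u \<in> Poly_Mapping.keys p"
  shows "u = 0 \<or> u \<in> \<Omega> \<or> mon_degree u \<ge> 2 * d"
proof -
  interpret cring "poly_ring {0..n} :: (nat, 'k) mpoly ring" by (rule poly_ring_cring)
  let ?P = "\<lambda>u. u = 0 \<or> u \<in> \<Omega> \<or> mon_degree u \<ge> 2 * d"
  have plus: "?P (u + v)" if "?P u" "?P v" for u v
  proof -
    have "mon_degree w = d" if "w \<in> \<Omega>" for w
      using that \<Omega> by (auto simp: monomials_def)
    then show ?thesis
      using that by (auto simp: mon_degree_add)
  qed
  have "\<forall>u\<in>Poly_Mapping.keys p. ?P u"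
    using p unfolding monomial_algebra_def
  proof (induction rule: generate_ring.induct)
    case one
    then show ?case by simp
  next
    case (incl h)
    then show ?case by (auto split: if_splits)
  next
    case (a_inv h)
    then have "h \<in> carrier (poly_ring {0..n})"
      using generate_ring_in_carrier[OF monomial_generators_closed[OF \<Omega>]] by blast
    with a_inv show ?case by (simp add: a_inv_poly_ring keys_uminus_mpoly del: poly_ring_simps(1))
  next
    case (eng_add h1 h2)
    then show ?case using Poly_Mapping.keys_add[of h1 h2] by fastforce
  next
    case (eng_mult h1 h2)
    show ?case
    proof
      fix w assume "w \<in> Poly_Mapping.keys (h1 \<otimes>\<^bsub>poly_ring {0..n}\<^esub> h2)"
      then obtain u v where "w = u + v" "u \<in> Poly_Mapping.keys h1" "v \<in> Poly_Mapping.keys h2"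
        using keys_mult[of h1 h2] by auto
      with eng_mult.IH plus show "?P w" by blast
    qed
  qed
  with u show ?thesis by blast
qed

lemma monomial_algebra_inject:
  assumes "d > 0" "\<Omega> \<subseteq> monomials n d" "\<Omega>' \<subseteq> monomials n d"
    and eq: "(monomial_algebra n \<Omega> :: (nat, 'k::field) mpoly set) = monomial_algebra n \<Omega>'"
  shows "\<Omega> = \<Omega>'"
proof -
  have sub: "A \<subseteq> B" if "A \<subseteq> monomials n d" "B \<subseteq> monomials n d"
    "(monomial_algebra n A :: (nat, 'k) mpoly set) = monomial_algebra n B" for A B
  proof
    fix m assume m: "m \<in> A"
    then have "(Poly_Mapping.single m 1 :: (nat, 'k) mpoly) \<in> monomial_algebra n A"
      unfolding monomial_algebra_def by (intro generate_ring.incl) auto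
    then have "m = 0 \<or> m \<in> B \<or> mon_degree m \<ge> 2 * d"
      using keys_monomial_algebra[OF that(2), of "Poly_Mapping.single m (1 :: 'k)" m] that(3)
      by simp
    moreover have "mon_degree m = d" using m that(1) by (auto simp: monomials_def)
    ultimately show "m \<in> B" using \<open>d > 0\<close> by (auto simp: mon_degree_def)
  qed
  from sub[OF assms(2,3) eq] sub[OF assms(3,2) eq[symmetric]] show ?thesis by blast
qed

lemma quadratic_monomial_algebra_iff:
  assumes "d > 0" "\<Omega> \<subseteq> monomials n d"
  shows "quadratic_algebra n d (monomial_algebra n \<Omega> :: (nat, 'k::field) mpoly set) \<longleftrightarrow>
    generated_by_quadrics \<Omega> (defining_ideal n \<Omega> :: (nat monomial, 'k) mpoly set)"
  using assms monomial_algebra_inject[where 'k = 'k, OF assms]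
  unfolding quadratic_algebra_def by blast

end

theory Submission
  imports Defs
begin

text \<open>
  Let \<open>s = \<lceil>(n + 2) / 2\<rceil>\<close> and call a monomial of degree \<open>d\<close> small if its support has at most \<open>s\<close>
  elements. Listing the variables in a suitable order and cutting a monomial of degree \<open>2 * d\<close> in
  the middle splits it into two small monomials, because the two halves share at most one
  variable. Hence every monomial of degree \<open>k * d\<close> with \<open>k \<ge> 2\<close> is a product of small ones.

  The defining ideal is spanned by the binomials \<open>u - v\<close> with \<open>u\<close>, \<open>v\<close> factorizations of the same
  monomial \<open>\<alpha>\<close>, and \<open>u\<close> is connected to \<open>v\<close> by quadratic moves by induction on the number \<open>k\<close> of
  factors: two factorizations sharing a factor are connected by the induction hypothesis. For
  \<open>k \<ge> 4\<close>, given factors \<open>a\<close> of \<open>u\<close> and \<open>b\<close> of \<open>v\<close>, the quotient of \<open>\<alpha>\<close> by the least common multiple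
  of \<open>a\<close> and \<open>b\<close> has degree at least \<open>2 * d\<close>, hence a small divisor \<open>c\<close>, and one passes through
  factorizations containing \<open>a c\<close> and \<open>b c\<close>. For \<open>k = 3\<close> one first makes the factors small and then
  walks from \<open>a\<close> to \<open>b\<close> through small divisors of \<open>\<alpha>\<close>, each time replacing a power \<open>x\<^sub>i^p\<close> by \<open>x\<^sub>j^p\<close>;
  balanced partitions of the variables show that the ends of each such step are connected.
\<close>

section \<open>Small divisors in degree three\<close>

text \<open>Elements of \<open>Q\<close> enter and elements of \<open>P\<close> leave, one pair at a
  time; \<open>q\<close> is the element whose entry first lifts the weight above \<open>t\<close>.
  The offset \<open>c\<close> carries what has already entered, which makes the induction on
  \<open>card P\<close> go through.\<close>

lemma exchange_path:
  fixes \<gamma> :: "'a \<Rightarrow> nat"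
  assumes "finite P" "finite Q" "card P = card Q"
    and "sum \<gamma> P + c \<le> t" "t < sum \<gamma> Q + c"
  shows "\<exists>R S q. R \<subseteq> P \<and> S \<subseteq> Q \<and> q \<in> Q - S \<and> card R + card S = card P \<and>
    sum \<gamma> R + sum \<gamma> S + c \<le> t \<and> t < sum \<gamma> R + sum \<gamma> S + \<gamma> q + c"
  using assms
proof (induction "card P" arbitrary: P Q c)
  case 0
  then show ?case by simp
next
  case (Suc m)
  then obtain p q where p: "p \<in> P" and q: "q \<in> Q"
    by (metis card.empty equals0I nat.distinct(1))
  show ?case
  proof (cases "t < sum \<gamma> P + \<gamma> q + c")
    case True
    then show ?thesis
      using Suc.prems q by (intro exI[of _ P] exI[of _ "{}"] exI[of _ q]) auto
  next
    case False
    have P: "sum \<gamma> P = \<gamma> p + sum \<gamma> (P - {p})" and Q: "sum \<gamma> Q = \<gamma> q + sum \<gamma> (Q - {q})"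
      using Suc.prems p q by (simp_all add: sum.remove)
    have "\<exists>R S r. R \<subseteq> P - {p} \<and> S \<subseteq> Q - {q} \<and> r \<in> Q - {q} - S \<and>
        card R + card S = card (P - {p}) \<and> sum \<gamma> R + sum \<gamma> S + (\<gamma> q + c) \<le> t \<and>
        t < sum \<gamma> R + sum \<gamma> S + \<gamma> r + (\<gamma> q + c)"
      by (rule Suc.hyps(1)) (use Suc.hyps(2) Suc.prems False p q P Q in auto)
    then obtain R S r where *: "R \<subseteq> P - {p}" "S \<subseteq> Q - {q}" "r \<in> Q - {q} - S"
        "card R + card S = card (P - {p})" "sum \<gamma> R + sum \<gamma> S + (\<gamma> q + c) \<le> t"
        "t < sum \<gamma> R + sum \<gamma> S + \<gamma> r + (\<gamma> q + c)"
      by blast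
    have "finite S" "q \<notin> S" using *(2) Suc.prems(2) finite_subset by auto
    moreover have "card P = Suc (card (P - {p}))"
      using Suc.prems p by (metis card_Suc_Diff1)
    ultimately show ?thesis
      using * q by (intro exI[of _ R] exI[of _ "insert q S"] exI[of _ r]) auto
  qed
qed

text \<open>A divisor of degree below that of \<open>\<gamma>\<close> has a variable with room left,
  so the degree can be raised one unit at a time.\<close>

lemma exists_divisor:
  fixes \<gamma> :: "'a \<Rightarrow> nat"
  assumes "finite X" "m \<le> sum \<gamma> X"
  shows "\<exists>c. (\<forall>x. c x \<le> \<gamma> x) \<and> sum c X = m"
  using assms(2)
proof (induction m)
  case 0
  then show ?case by (intro exI[of _ "\<lambda>_. 0"]) auto
next
  case (Suc m)
  then obtain c where c: "\<forall>x. c x \<le> \<gamma> x" "sum c X = m" by auto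
  then have "\<not> (\<forall>x\<in>X. \<gamma> x \<le> c x)"
    using Suc.prems sum_mono[of X \<gamma> c] by auto
  then obtain x where x: "x \<in> X" "c x < \<gamma> x" by force
  have "sum (c(x := Suc (c x))) X = Suc (sum c X)"
    using x assms(1) by (simp add: sum.remove[of X x])
  then show ?case
    using c x by (intro exI[of _ "c(x := Suc (c x))"]) auto
qed

abbreviation unit_at :: "'a \<Rightarrow> 'a \<Rightarrow> nat" where
  "unit_at i x \<equiv> of_bool (x = i)"

section \<open>The graph of small divisors and balanced partitions\<close>

locale odd_support =
  fixes X :: "'a set" and h d :: nat
  assumes finX: "finite X" and cardX: "card X = 2 * h + 1" and h_pos: "h \<ge> 1"
begin

text \<open>With \<open>2 * h + 1\<close> variables, \<open>h + 1\<close> is the size of one half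
  together with the middle variable that both halves share.\<close>

definition small :: "('a \<Rightarrow> nat) \<Rightarrow> bool" where
  "small f \<longleftrightarrow> (\<forall>x. x \<notin> X \<longrightarrow> f x = 0) \<and> sum f X = d \<and> card {x. f x \<noteq> 0} \<le> h + 1"

text \<open>An edge together with its cofactor \<open>c\<close> is a factorization of
  \<open>\<alpha>\<close> into three small monomials. The factorizations at two edges with a common
  vertex share that factor, so a path becomes a chain of quadratic moves.\<close>

definition adj :: "('a \<Rightarrow> nat) \<Rightarrow> ('a \<Rightarrow> nat) \<Rightarrow> ('a \<Rightarrow> nat) \<Rightarrow> bool" where
  "adj \<alpha> a b \<longleftrightarrow> small a \<and> small b \<and> (\<exists>c. small c \<and> (\<forall>x. a x + b x + c x = \<alpha> x))"

abbreviation conn :: "('a \<Rightarrow> nat) \<Rightarrow> ('a \<Rightarrow> nat) \<Rightarrow> ('a \<Rightarrow> nat) \<Rightarrow> bool" where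
  "conn \<alpha> \<equiv> (adj \<alpha>)\<^sup>*\<^sup>*"

lemma adj_sym: "adj \<alpha> a b \<Longrightarrow> adj \<alpha> b a"
  unfolding adj_def by (metis add.commute)

lemma conn_sym: "conn \<alpha> a b \<Longrightarrow> conn \<alpha> b a"
  using symp_rtranclp[of "adj \<alpha>"] adj_sym by (auto intro: sympI dest: sympD)

lemma conn_trans: "conn \<alpha> a b \<Longrightarrow> conn \<alpha> b c \<Longrightarrow> conn \<alpha> a c"
  by (rule rtranclp_trans)

lemma adj_conn: "adj \<alpha> a b \<Longrightarrow> conn \<alpha> a b"
  by (rule r_into_rtranclp)

lemma finite_supp: "\<forall>x. x \<notin> X \<longrightarrow> f x = (0::nat) \<Longrightarrow> finite {x. f x \<noteq> 0}"
  by (rule finite_subset[OF _ finX]) auto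

text \<open>
  If \<open>A\<close> and \<open>B\<close> carry degree at most \<open>t\<close>, the variable \<open>l\<close> can be shared out so as to top both up
  to any prescribed degrees, and both factors then have support of size at most \<open>h + 1\<close>.
\<close>

definition balanced :: "('a \<Rightarrow> nat) \<Rightarrow> nat \<Rightarrow> 'a set \<Rightarrow> 'a \<Rightarrow> 'a set \<Rightarrow> bool" where
  "balanced \<gamma> t A l B \<longleftrightarrow> X = insert l (A \<union> B) \<and> l \<notin> A \<union> B \<and> A \<inter> B = {} \<and>
    card A = h \<and> card B = h \<and> sum \<gamma> A \<le> t \<and> sum \<gamma> B \<le> t"

lemma balanced_sym: "balanced \<gamma> t A l B \<Longrightarrow> balanced \<gamma> t B l A"
  unfolding balanced_def by auto

text \<open>\<open>A\<close> and \<open>l\<close> together carry at least \<open>t + 1\<close> of a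
  total of at most \<open>2 * t + 1\<close>, which leaves at most \<open>t\<close> for the
  complement.\<close>

lemma balancedI:
  assumes "A \<subseteq> X" "l \<in> X - A" "card A = h" "sum \<gamma> A \<le> t" "t < sum \<gamma> A + \<gamma> l"
    and "sum \<gamma> X \<le> 2 * t + 1"
  shows "balanced \<gamma> t A l (X - insert l A)"
proof -
  have fA: "finite A" using assms(1) finX finite_subset by blast
  have "insert l A \<subseteq> X" using assms by auto
  then have "sum \<gamma> X = sum \<gamma> (insert l A) + sum \<gamma> (X - insert l A)"
    using finX by (metis sum.subset_diff add.commute)
  moreover have "card (X - insert l A) = h"
    using assms fA cardX \<open>insert l A \<subseteq> X\<close> by (subst card_Diff_subset) auto
  moreover have "sum \<gamma> (insert l A) = \<gamma> l + sum \<gamma> A" using assms fA by simp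
  ultimately show ?thesis using assms unfolding balanced_def by auto
qed

text \<open>
  Exchange the elements of two disjoint \<open>h\<close>-sets one at a time; at the step where the degree first
  exceeds \<open>t\<close>, the entering element is \<open>l\<close>. Exchanging \<open>j\<close> and \<open>k\<close> first or last keeps \<open>i\<close> and \<open>j\<close> on
  the same side unless \<open>l = k\<close>.
\<close>

lemma exists_balanced:
  assumes "sum \<gamma> X \<le> 2 * t + 1" and ijk: "i \<in> X" "j \<in> X" "k \<in> X" "i \<noteq> j" "i \<noteq> k" "j \<noteq> k"
  shows "\<exists>A l B. balanced \<gamma> t A l B \<and> (l = k \<or> i \<in> insert l A \<and> j \<in> insert l A)"
proof -
  \<comment> \<open>The starting partition has \<open>i\<close> in the middle, \<open>j\<close> with
    \<open>P\<close> on one side and \<open>k\<close> with \<open>Q\<close> on the other.\<close>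
  let ?Y = "X - {i, j, k}"
  have "card ?Y = 2 * h - 2" using ijk cardX finX by (simp add: card_Diff_subset)
  then have "h - 1 \<le> card ?Y" by simp
  then obtain P where P: "P \<subseteq> ?Y" "card P = h - 1"
    by (meson obtain_subset_with_card_n)
  define Q where "Q = ?Y - P"
  have fP: "finite P" and fQ: "finite Q"
    using P finX finite_subset unfolding Q_def by auto
  have cQ: "card Q = h - 1"
    using \<open>card ?Y = _\<close> P fP unfolding Q_def by (subst card_Diff_subset) auto
  have PQ: "X = insert i (insert j P \<union> insert k Q)" "P \<inter> Q = {}" "Q \<subseteq> ?Y"
    using P ijk unfolding Q_def by auto
  have nin: "i \<notin> P" "j \<notin> P" "k \<notin> P" "i \<notin> Q" "j \<notin> Q" "k \<notin> Q" using P PQ by auto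
  have sP: "sum \<gamma> (insert j P) = \<gamma> j + sum \<gamma> P" and sQ: "sum \<gamma> (insert k Q) = \<gamma> k + sum \<gamma> Q"
    using fP fQ nin by auto
  have cP': "card (insert j P) = h" and cQ': "card (insert k Q) = h"
    using fP fQ nin P cQ h_pos by auto
  have "sum \<gamma> X = \<gamma> i + (sum \<gamma> (insert j P) + sum \<gamma> (insert k Q))"
  proof -
    have "sum \<gamma> (insert j P \<union> insert k Q) = sum \<gamma> (insert j P) + sum \<gamma> (insert k Q)"
      using fP fQ nin PQ(2) ijk by (intro sum.union_disjoint) auto
    then show ?thesis using fP fQ nin ijk by (subst PQ(1), subst sum.insert) auto
  qed
  with assms(1) have tot: "\<gamma> i + (\<gamma> j + sum \<gamma> P) + (\<gamma> k + sum \<gamma> Q) \<le> 2 * t + 1"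
    using sP sQ by simp
  \<comment> \<open>If neither \<open>i\<close> nor \<open>j\<close> is in \<open>A\<close>, each is
    \<open>l\<close> or lies in the complement, and swapping the two sides gives the required
    form.\<close>
  have bal: "\<exists>A l B. balanced \<gamma> t A l B \<and> (l = k \<or> i \<in> insert l A \<and> j \<in> insert l A)"
    if "A \<subseteq> X" "l \<in> X - A" "card A = h" "sum \<gamma> A \<le> t" "t < sum \<gamma> A + \<gamma> l"
      "l = k \<or> i \<notin> A \<and> j \<notin> A" for A l
    using balanced_sym[OF balancedI[OF that(1-5) assms(1)]]
      balancedI[OF that(1-5) assms(1)] that(6) ijk by fastforce
  \<comment> \<open>The two sides cannot both exceed \<open>t\<close>. If exactly one does, the walk
    goes from the lighter side to the heavier one: towards \<open>Q\<close> the exchange of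
    \<open>j\<close> for \<open>k\<close> comes first, towards \<open>P\<close> that of
    \<open>k\<close> for \<open>j\<close> comes last.\<close>
  consider "\<gamma> j + sum \<gamma> P \<le> t" "\<gamma> k + sum \<gamma> Q \<le> t"
    | "\<gamma> j + sum \<gamma> P \<le> t" "t < \<gamma> k + sum \<gamma> Q" "t < \<gamma> j + sum \<gamma> P + \<gamma> k"
    | "\<gamma> j + sum \<gamma> P \<le> t" "t < \<gamma> k + sum \<gamma> Q" "\<gamma> j + sum \<gamma> P + \<gamma> k \<le> t"
    | "t < \<gamma> j + sum \<gamma> P" "\<gamma> k + sum \<gamma> Q \<le> t" "\<gamma> k + sum \<gamma> P \<le> t"
    | "t < \<gamma> j + sum \<gamma> P" "\<gamma> k + sum \<gamma> Q \<le> t" "t < \<gamma> k + sum \<gamma> P"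
    using tot by linarith
  then show ?thesis
  proof cases
    case 1
    then have "balanced \<gamma> t (insert j P) i (insert k Q)"
      unfolding balanced_def using PQ nin ijk cP' cQ' sP sQ by auto
    then show ?thesis by blast
  next
    case 2
    show ?thesis
      by (rule bal[of "insert j P" k]) (use 2 PQ(1) nin ijk cP' sP in auto)
  next
    case 3
    then obtain R S q where *: "R \<subseteq> P" "S \<subseteq> Q" "q \<in> Q - S" "card R + card S = card P"
      "sum \<gamma> R + sum \<gamma> S + \<gamma> k \<le> t" "t < sum \<gamma> R + sum \<gamma> S + \<gamma> q + \<gamma> k"
      using exchange_path[OF fP fQ, of \<gamma> "\<gamma> k" t] P cQ by auto
    have f: "finite R" "finite S" using * fP fQ finite_subset by auto
    have "sum \<gamma> (insert k (R \<union> S)) = \<gamma> k + (sum \<gamma> R + sum \<gamma> S)"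
      using f * nin PQ(2) by (subst sum.insert, auto)+ (subst sum.union_disjoint, auto)
    moreover have "card (insert k (R \<union> S)) = h"
      using f * nin PQ(2) P h_pos by (subst card_insert_disjoint, auto)+ (subst card_Un_disjoint, auto)
    ultimately show ?thesis
      by (intro bal[of "insert k (R \<union> S)" q]) (use * PQ nin ijk in auto)
  next
    case 4
    show ?thesis
      by (rule bal[of "insert k P" j]) (use 4 PQ(1) nin ijk fP P h_pos in auto)
  next
    case 5
    \<comment> \<open>Here \<open>k\<close> stays in the set while \<open>Q\<close> is exchanged for
      \<open>P\<close>, hence the offset \<open>\<gamma> k\<close>.\<close>
    then obtain R S q where *: "R \<subseteq> Q" "S \<subseteq> P" "q \<in> P - S" "card R + card S = card Q"
      "sum \<gamma> R + sum \<gamma> S + \<gamma> k \<le> t" "t < sum \<gamma> R + sum \<gamma> S + \<gamma> q + \<gamma> k"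
      using exchange_path[OF fQ fP, of \<gamma> "\<gamma> k" t] P cQ by auto
    have f: "finite R" "finite S" using * fP fQ finite_subset by auto
    have "sum \<gamma> (insert k (R \<union> S)) = \<gamma> k + (sum \<gamma> R + sum \<gamma> S)"
      using f * nin PQ(2) by (subst sum.insert, auto)+ (subst sum.union_disjoint, auto)
    moreover have "card (insert k (R \<union> S)) = h"
      using f * nin PQ(2) cQ h_pos by (subst card_insert_disjoint, auto)+ (subst card_Un_disjoint, auto)
    ultimately show ?thesis
      by (intro bal[of "insert k (R \<union> S)" q]) (use * PQ nin ijk in auto)
  qed
qed

section \<open>Topping up at the middle variable\<close>

text \<open>The variable \<open>l\<close> receives the degree that is missing; wherever this is used
  \<open>sum f A\<close> is at most \<open>d\<close>, so the truncated difference is the true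
  one.\<close>

definition fill :: "'a set \<Rightarrow> 'a \<Rightarrow> ('a \<Rightarrow> nat) \<Rightarrow> 'a \<Rightarrow> nat" where
  "fill A l f = (\<lambda>x. if x \<in> A then f x else if x = l then d - sum f A else 0)"

lemma small_fill:
  assumes "balanced \<gamma> t A l B" "sum f A \<le> d"
  shows "small (fill A l f)"
proof -
  have *: "A \<subseteq> X" "l \<in> X" "l \<notin> A" "card A = h" using assms(1) unfolding balanced_def by auto
  then have fA: "finite A" using finX finite_subset by blast
  have "sum (fill A l f) X = sum (fill A l f) (insert l A)"
    by (rule sum.mono_neutral_right) (use * finX in \<open>auto simp: fill_def\<close>)
  also have "\<dots> = d - sum f A + sum (fill A l f) A"
    using * fA by (simp add: fill_def)
  also have "sum (fill A l f) A = sum f A" by (intro sum.cong) (auto simp: fill_def)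
  finally have "sum (fill A l f) X = d" using assms by simp
  moreover have "card {x. fill A l f x \<noteq> 0} \<le> card (insert l A)"
    by (rule card_mono) (use fA in \<open>auto simp: fill_def split: if_splits\<close>)
  ultimately show ?thesis using * fA unfolding small_def by (auto simp: fill_def)
qed

text \<open>Both sides have total degree \<open>3 * d\<close>, so agreement off the one variable
  \<open>l\<close> forces agreement at \<open>l\<close>. This spares computing the exponents that
  \<open>fill\<close> places there.\<close>

lemma adjI:
  assumes "small a" "small b" "small c" "\<forall>x. x \<notin> X \<longrightarrow> \<alpha> x = 0" "sum \<alpha> X = 3 * d"
    and eq: "\<And>x. x \<in> X \<Longrightarrow> x \<noteq> l \<Longrightarrow> a x + b x + c x = \<alpha> x"
  shows "adj \<alpha> a b"
proof -
  have "a x + b x + c x = \<alpha> x" for x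
  proof (cases "x \<in> X")
    case True
    have tot: "(\<Sum>x\<in>X. a x + b x + c x) = sum \<alpha> X"
      using assms unfolding small_def by (simp add: sum.distrib)
    show ?thesis
    proof (cases "x = l")
      case True
      have "(\<Sum>x\<in>X - {l}. a x + b x + c x) = sum \<alpha> (X - {l})"
        using eq by (intro sum.cong) auto
      with tot finX \<open>x \<in> X\<close> True show ?thesis by (simp add: sum.remove[of X l])
    qed (use eq True in auto)
  qed (use assms in \<open>auto simp: small_def\<close>)
  with assms(1-3) show ?thesis unfolding adj_def by (intro conjI exI[of _ c]) auto
qed

lemma small_cong_supp:
  assumes "small f" "\<forall>x. x \<notin> X \<longrightarrow> g x = 0" "sum g X = d" "{x. g x \<noteq> 0} \<subseteq> {x. f x \<noteq> 0}"
  shows "small g"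
proof -
  have "card {x. g x \<noteq> 0} \<le> card {x. f x \<noteq> 0}"
    using assms by (intro card_mono finite_supp) (auto simp: small_def)
  with assms show ?thesis unfolding small_def by auto
qed

lemma sum_unit_at: "i \<in> X \<Longrightarrow> sum (unit_at i) X = 1"
  using finX by (simp add: of_bool_def)

lemma sum_add_unit_at:
  "finite A \<Longrightarrow> (\<Sum>x\<in>A. f x + unit_at i x) = sum f A + of_bool (i \<in> A)"
  by (simp add: sum.distrib of_bool_def)

section \<open>Exchanging a single variable of a small divisor\<close>

context
  fixes \<alpha> \<gamma> g :: "'a \<Rightarrow> nat" and i j :: 'a
  assumes small_i: "small (\<lambda>x. g x + unit_at i x)" and small_j: "small (\<lambda>x. g x + unit_at j x)"
    and ij: "i \<noteq> j"
    and \<alpha>: "\<And>x. \<alpha> x = \<gamma> x + (g x + unit_at i x + unit_at j x)"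
    and \<alpha>0: "\<forall>x. x \<notin> X \<longrightarrow> \<alpha> x = 0" and \<alpha>_deg: "sum \<alpha> X = 3 * d"
begin

lemma ijX: "i \<in> X" "j \<in> X"
proof -
  have "g i + unit_at i i = 0" if "i \<notin> X" using small_i that unfolding small_def by blast
  moreover have "g j + unit_at j j = 0" if "j \<notin> X" using small_j that unfolding small_def by blast
  ultimately show "i \<in> X" "j \<in> X" by auto
qed

text \<open>The least common multiple of the two divisors is \<open>g x\<^sub>i x\<^sub>j\<close>,
  and \<open>\<gamma>\<close> is its cofactor in \<open>\<alpha>\<close>. Its degree is
  \<open>2 * (d - 1) + 1\<close>, just what a balanced partition with threshold \<open>d - 1\<close>
  can handle.\<close>

lemma degree_pos: "d \<ge> 1" and g_deg: "sum g X = d - 1" and \<gamma>_deg: "sum \<gamma> X = 2 * d - 1"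
proof -
  have g: "sum g X + 1 = d"
    using small_i ijX finX unfolding small_def by (simp add: sum_add_unit_at)
  then show "d \<ge> 1" "sum g X = d - 1" by auto
  have "sum \<alpha> X = sum \<gamma> X + (sum g X + 1 + 1)"
    unfolding \<alpha> using ijX finX by (simp add: sum.distrib sum_unit_at)
  then show "sum \<gamma> X = 2 * d - 1" using g \<alpha>_deg by simp
qed

text \<open>The factor \<open>c\<close> draws only on the side without \<open>i\<close> and
  \<open>j\<close> and on \<open>l\<close>, which makes it a common neighbour: the third factor is
  \<open>u j\<close> next to \<open>g x\<^sub>i\<close> and \<open>u i\<close> next to
  \<open>g x\<^sub>j\<close>. The threshold \<open>d - 1\<close> leaves room for the extra unit in
  \<open>u\<close>.\<close>

lemma conn_same_side:
  assumes bal: "balanced \<gamma> (d - 1) A l B" and side: "i \<in> insert l A" "j \<in> insert l A"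
  shows "conn \<alpha> (\<lambda>x. g x + unit_at i x) (\<lambda>x. g x + unit_at j x)"
proof -
  have P: "X = insert l (A \<union> B)" "l \<notin> A \<union> B" "A \<inter> B = {}" "sum \<gamma> A \<le> d - 1" "sum \<gamma> B \<le> d - 1"
    using bal unfolding balanced_def by auto
  have f: "finite A" "finite B" using P finX by auto
  define c where "c = fill B l \<gamma>"
  define u where "u k = fill A l (\<lambda>x. \<gamma> x + unit_at k x)" for k
  have sc: "small c" unfolding c_def by (rule small_fill[OF balanced_sym[OF bal]]) (use P in auto)
  have su: "small (u k)" for k
    unfolding u_def by (rule small_fill[OF bal]) (use P degree_pos f in \<open>auto simp: sum_add_unit_at\<close>)
  have 1: "adj \<alpha> (\<lambda>x. g x + unit_at i x) c"
    by (rule adjI[OF small_i sc su[of j] \<alpha>0 \<alpha>_deg, of l])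
      (use P side in \<open>auto simp: \<alpha> c_def u_def fill_def\<close>)
  have 2: "adj \<alpha> (\<lambda>x. g x + unit_at j x) c"
    by (rule adjI[OF small_j sc su[of i] \<alpha>0 \<alpha>_deg, of l])
      (use P side in \<open>auto simp: \<alpha> c_def u_def fill_def\<close>)
  show ?thesis
    by (rule conn_trans[OF adj_conn[OF 1] adj_conn[OF adj_sym[OF 2]]])
qed

text \<open>The path is \<open>g x\<^sub>i\<close>, \<open>q'\<close>, \<open>p'\<close>,
  \<open>g x\<^sub>j\<close>, with third factors \<open>p\<close>, \<open>g x\<^sub>l\<close> and
  \<open>q\<close>.\<close>

lemma conn_separated:
  assumes bal: "balanced \<gamma> (d - 1) A l B" and side: "i \<in> A" "j \<in> B"
    and sl: "small (\<lambda>x. g x + unit_at l x)"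
  shows "conn \<alpha> (\<lambda>x. g x + unit_at i x) (\<lambda>x. g x + unit_at j x)"
proof -
  have P: "X = insert l (A \<union> B)" "l \<notin> A \<union> B" "A \<inter> B = {}" "sum \<gamma> A \<le> d - 1" "sum \<gamma> B \<le> d - 1"
    using bal unfolding balanced_def by auto
  have f: "finite A" "finite B" using P finX by auto
  note S = small_fill[OF bal] small_fill[OF balanced_sym[OF bal]]
  define p p' q q' where "p = fill A l \<gamma>" and "p' = fill A l (\<lambda>x. \<gamma> x + unit_at i x)"
    and "q = fill B l \<gamma>" and "q' = fill B l (\<lambda>x. \<gamma> x + unit_at j x)"
  note defs = p_def p'_def q_def q'_def
  have s: "small p" "small p'" "small q" "small q'"
    unfolding defs by (rule S; use P degree_pos f in \<open>auto simp: sum_add_unit_at\<close>)+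
  have 1: "adj \<alpha> (\<lambda>x. g x + unit_at i x) q'"
    by (rule adjI[OF small_i s(4) s(1) \<alpha>0 \<alpha>_deg, of l])
      (use P side in \<open>auto simp: \<alpha> defs fill_def\<close>)
  have 2: "adj \<alpha> q' p'"
    by (rule adjI[OF s(4) s(2) sl \<alpha>0 \<alpha>_deg, of l])
      (use P side in \<open>auto simp: \<alpha> defs fill_def\<close>)
  have 3: "adj \<alpha> p' (\<lambda>x. g x + unit_at j x)"
    by (rule adjI[OF s(2) small_j s(3) \<alpha>0 \<alpha>_deg, of l])
      (use P side in \<open>auto simp: \<alpha> defs fill_def\<close>)
  show ?thesis
    by (rule conn_trans[OF conn_trans[OF adj_conn[OF 1] adj_conn[OF 2]] adj_conn[OF 3]])
qed

text \<open>A detour of length four that avoids the divisor \<open>g x\<^sub>l\<close>, which need not be small.\<close>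

lemma conn_separated':
  assumes bal: "balanced \<gamma> (d - 1) A l B" and side: "i \<in> A" "j \<in> B" and gl: "g l = 0"
    and B: "sum \<gamma> B + sum g B < d"
  shows "conn \<alpha> (\<lambda>x. g x + unit_at i x) (\<lambda>x. g x + unit_at j x)"
proof -
  have P: "X = insert l (A \<union> B)" "l \<notin> A \<union> B" "A \<inter> B = {}" "sum \<gamma> A \<le> d - 1" "sum \<gamma> B \<le> d - 1"
    using bal unfolding balanced_def by auto
  have f: "finite A" "finite B" using P finX by auto
  have gA: "sum g A \<le> d - 1"
    using sum_mono2[of X A g] finX P g_deg by auto
  have gB: "(\<Sum>x\<in>B. \<gamma> x + g x) = sum \<gamma> B + sum g B" by (rule sum.distrib)
  note S = small_fill[OF bal] small_fill[OF balanced_sym[OF bal]]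
  \<comment> \<open>The path is \<open>g x\<^sub>i\<close>, \<open>p\<close>, \<open>s\<close>,
    \<open>p'\<close>, \<open>g x\<^sub>j\<close>, with third factors \<open>q'\<close>,
    \<open>r'\<close>, \<open>r\<close> and \<open>q\<close>. The factor \<open>s\<close> takes the
    whole \<open>B\<close>-part of \<open>\<alpha>\<close>, and the bound \<open>B\<close> keeps
    that part within degree \<open>d\<close>.\<close>
  define p p' r r' q q' s where "p = fill A l \<gamma>" and "p' = fill A l (\<lambda>x. \<gamma> x + unit_at i x)"
    and "r = fill A l g" and "r' = fill A l (\<lambda>x. g x + unit_at i x)"
    and "q = fill B l \<gamma>" and "q' = fill B l (\<lambda>x. \<gamma> x + unit_at j x)"
    and "s = fill B l (\<lambda>x. \<gamma> x + g x + unit_at j x)"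
  note defs = p_def p'_def q_def q'_def r_def r'_def s_def
  have s: "small p" "small p'" "small q" "small q'" "small r" "small r'" "small s"
    unfolding defs
    by (rule S; use P degree_pos f gA B gB in \<open>auto simp: sum_add_unit_at\<close>)+
  have 1: "adj \<alpha> (\<lambda>x. g x + unit_at i x) p"
    by (rule adjI[OF small_i s(1) s(4) \<alpha>0 \<alpha>_deg, of l])
      (use P side in \<open>auto simp: \<alpha> defs fill_def\<close>)
  have 2: "adj \<alpha> p s"
    by (rule adjI[OF s(1) s(7) s(6) \<alpha>0 \<alpha>_deg, of l])
      (use P side in \<open>auto simp: \<alpha> defs fill_def\<close>)
  have 3: "adj \<alpha> s p'"
    by (rule adjI[OF s(7) s(2) s(5) \<alpha>0 \<alpha>_deg, of l])
      (use P side in \<open>auto simp: \<alpha> defs fill_def\<close>)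
  have 4: "adj \<alpha> p' (\<lambda>x. g x + unit_at j x)"
    by (rule adjI[OF s(2) small_j s(3) \<alpha>0 \<alpha>_deg, of l])
      (use P side in \<open>auto simp: \<alpha> defs fill_def\<close>)
  show ?thesis
    by (rule conn_trans[OF conn_trans[OF conn_trans[OF adj_conn[OF 1] adj_conn[OF 2]] adj_conn[OF 3]] adj_conn[OF 4]])
qed

end

text \<open>The delicate case is a partition separating \<open>i\<close> and \<open>j\<close> around
  \<open>k\<close>. For \<open>k\<close> in the support of \<open>g\<close>, the divisor
  \<open>g x\<^sub>k\<close> is small. If \<open>g\<close> has no variable besides \<open>i\<close>
  and \<open>j\<close>, it can fail to be small only for \<open>h = 1\<close>, and three variables
  are treated by hand.\<close>

lemma conn_unit_step:
  assumes small_i: "small (\<lambda>x. g x + unit_at i x)" and small_j: "small (\<lambda>x. g x + unit_at j x)"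
    and ij: "i \<noteq> j" and \<alpha>0: "\<forall>x. x \<notin> X \<longrightarrow> \<alpha> x = 0" and \<alpha>_deg: "sum \<alpha> X = 3 * d"
    and le: "\<And>x. g x + unit_at i x + unit_at j x \<le> \<alpha> x"
  shows "conn \<alpha> (\<lambda>x. g x + unit_at i x) (\<lambda>x. g x + unit_at j x)"
proof -
  define \<gamma> where "\<gamma> x = \<alpha> x - (g x + unit_at i x + unit_at j x)" for x
  have \<alpha>: "\<alpha> x = \<gamma> x + (g x + unit_at i x + unit_at j x)" for x
    using le[of x] unfolding \<gamma>_def by simp
  then have \<alpha>': "\<alpha> x = \<gamma> x + (g x + unit_at j x + unit_at i x)" for x
    by (simp add: add_ac)
  note ctx = small_i small_j ij \<alpha> \<alpha>0 \<alpha>_deg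
  note X = ijX[OF ctx] and degs = degree_pos[OF ctx] g_deg[OF ctx] \<gamma>_deg[OF ctx]
  have "card (X - {i, j}) > 0"
    using X ij cardX finX h_pos by (simp add: card_Diff_subset)
  then have ne: "X - {i, j} \<noteq> {}" using card_gt_0_iff by blast
  have g0: "g x = 0" if "x \<notin> X" for x using small_i that unfolding small_def by auto
  obtain k where k: "k \<in> X" "k \<noteq> i" "k \<noteq> j" "g k = 0 \<longrightarrow> {x. g x \<noteq> 0} \<subseteq> {i, j}"
  proof (cases "{x. g x \<noteq> 0} \<subseteq> {i, j}")
    case True
    then show ?thesis using that ne by blast
  next
    case False
    then obtain k where "g k \<noteq> 0" "k \<noteq> i" "k \<noteq> j" by auto
    moreover from this have "k \<in> X" using g0[of k] by auto
    ultimately show ?thesis using that by auto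
  qed
  have "sum \<gamma> X \<le> 2 * (d - 1) + 1" using degs by simp
  from exists_balanced[OF this X(1,2) k(1) ij k(2,3)[symmetric]]
  obtain A l B where bal: "balanced \<gamma> (d - 1) A l B"
    and l: "l = k \<or> i \<in> insert l A \<and> j \<in> insert l A" by blast
  have sep: ?thesis if bal: "balanced \<gamma> (d - 1) A k B" and side: "i \<in> A" "j \<in> B" for A B
  proof (cases "small (\<lambda>x. g x + unit_at k x)")
    case True
    then show ?thesis using conn_separated[OF ctx bal side] by blast
  next
    case False
    have deg: "(\<Sum>x\<in>X. g x + unit_at k x) = d"
      using degs k finX by (simp add: sum_add_unit_at)
    \<comment> \<open>Otherwise the support of \<open>g x\<^sub>k\<close> would lie inside that of
      the small \<open>g x\<^sub>i\<close>.\<close>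
    have gk: "g k = 0"
    proof (rule ccontr)
      assume "g k \<noteq> 0"
      then have "small (\<lambda>x. g x + unit_at k x)"
        by (intro small_cong_supp[OF small_i] deg) (use g0 k in auto)
      with False show False ..
    qed
    have h: "h = 1"
    proof (rule ccontr)
      assume "h \<noteq> 1"
      moreover have "card {x. g x + unit_at k x \<noteq> 0} \<le> card {i, j, k}"
        using gk k(4) by (intro card_mono) auto
      moreover have "card {i, j, k} \<le> 3" by (simp add: card_insert_if)
      ultimately have "small (\<lambda>x. g x + unit_at k x)"
        unfolding small_def using deg h_pos g0 k by auto
      with False show False ..
    qed
    then have A: "A = {i}" and B: "B = {j}"
      using bal side unfolding balanced_def by (auto simp: card_1_singleton_iff)
    have X3: "X = {i, j, k}" using bal A B unfolding balanced_def by auto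
    have sums: "\<gamma> i + \<gamma> j + \<gamma> k = 2 * d - 1" "g i + g j = d - 1"
      using degs X3 k ij gk by auto
    \<comment> \<open>If all three failed, \<open>\<gamma> i + \<gamma> j\<close> would be at most
      \<open>d - 1\<close>, and adding \<open>g i + g j = d - 1\<close> would give less than
      \<open>2 * d\<close>. In the first case \<open>i\<close> can serve as the middle
      variable.\<close>
    consider "\<gamma> k \<le> d - 1" | "\<gamma> j + g j < d" | "\<gamma> i + g i < d"
      using sums degs by linarith
    then show ?thesis
    proof cases
      case 1
      then have "balanced \<gamma> (d - 1) {j} i {k}"
        using bal h ij k unfolding balanced_def A B by auto
      then show ?thesis using conn_same_side[OF ctx] by blast
    next
      case 2
      then show ?thesis using conn_separated'[OF ctx bal side gk] B by simp
    next
      case 3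
      then show ?thesis
        using conn_separated'[OF small_j small_i ij[symmetric] \<alpha>' \<alpha>0 \<alpha>_deg
            balanced_sym[OF bal] side(2,1) gk] A
        by (auto intro: conn_sym)
    qed
  qed
  have "X = insert l (A \<union> B)" using bal unfolding balanced_def by blast
  then consider "i \<in> insert l A" "j \<in> insert l A" | "i \<in> insert l B" "j \<in> insert l B"
    | "l = k" "i \<in> A" "j \<in> B" | "l = k" "i \<in> B" "j \<in> A"
    using l X k by blast
  then show ?thesis
  proof cases
    case 1
    then show ?thesis using conn_same_side[OF ctx bal] by blast
  next
    case 2
    then show ?thesis using conn_same_side[OF ctx balanced_sym[OF bal]] by blast
  next
    case 3
    then show ?thesis using sep bal by blast
  next
    case 4
    then show ?thesis using sep balanced_sym[OF bal] by blast
  qed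
qed

text \<open>
  A variable \<open>l\<close> in the support of \<open>g\<close> with room in \<open>\<alpha>\<close> lets unit steps lower \<open>p\<close>. If there is none,
  the cofactor lives on the \<open>h + 1\<close> variables outside the support of \<open>g\<close>, so that every
  divisor of it is small.
\<close>

lemma conn_shift:
  assumes "small (\<lambda>x. g x + p * unit_at i x)" "small (\<lambda>x. g x + p * unit_at j x)"
    and ij: "i \<noteq> j" and "g i = 0" "g j = 0" "card {x. g x \<noteq> 0} = h"
    and \<alpha>0: "\<forall>x. x \<notin> X \<longrightarrow> \<alpha> x = 0" and \<alpha>_deg: "sum \<alpha> X = 3 * d"
    and "\<And>x. g x + p * unit_at i x + p * unit_at j x \<le> \<alpha> x"
  shows "conn \<alpha> (\<lambda>x. g x + p * unit_at i x) (\<lambda>x. g x + p * unit_at j x)"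
  using assms(1,2,4-6,9)
proof (induction p arbitrary: g)
  case 0
  then show ?case by simp
next
  case (Suc p)
  note small_i = Suc.prems(1) and small_j = Suc.prems(2) and le = Suc.prems(6)
  have iX: "i \<in> X" "j \<in> X"
  proof -
    have "g i + Suc p * unit_at i i = 0" if "i \<notin> X"
      using small_i that unfolding small_def by blast
    moreover have "g j + Suc p * unit_at j j = 0" if "j \<notin> X"
      using small_j that unfolding small_def by blast
    ultimately show "i \<in> X" "j \<in> X" by auto
  qed
  have gX: "g x = 0" if "x \<notin> X" for x using small_i that unfolding small_def by auto
  have g_deg: "sum g X + Suc p = d"
  proof -
    have "(\<Sum>x\<in>X. g x + Suc p * unit_at i x) = sum g X + Suc p * sum (unit_at i) X"
      unfolding sum.distrib sum_distrib_left ..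
    then show ?thesis using small_i iX unfolding small_def by (simp add: sum_unit_at)
  qed
  show ?case
  proof (cases "\<exists>l. g l \<noteq> 0 \<and> g l < \<alpha> l")
    case True
    then obtain l where l: "g l \<noteq> 0" "g l < \<alpha> l" by blast
    then have lX: "l \<in> X" "l \<noteq> i" "l \<noteq> j" using gX[of l] Suc.prems(3,4) by auto
    let ?g = "\<lambda>x. g x + unit_at l x"
    \<comment> \<open>One of the \<open>Suc p\<close> copies of \<open>x\<^sub>m\<close> is traded
      for \<open>x\<^sub>l\<close>, which leaves the support of \<open>g\<close> unchanged. Doing so
      at both ends reduces the claim to the induction hypothesis for \<open>g x\<^sub>l\<close> and
      \<open>p\<close>.\<close>
    have step: "small (\<lambda>x. ?g x + p * unit_at m x) \<and>
        conn \<alpha> (\<lambda>x. g x + Suc p * unit_at m x) (\<lambda>x. ?g x + p * unit_at m x)"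
      if m: "small (\<lambda>x. g x + Suc p * unit_at m x)" "m \<in> {i, j}" for m
    proof -
      have eq: "(\<lambda>x. g x + Suc p * unit_at m x) = (\<lambda>x. (g x + p * unit_at m x) + unit_at m x)"
        "(\<lambda>x. ?g x + p * unit_at m x) = (\<lambda>x. (g x + p * unit_at m x) + unit_at l x)"
        by (auto simp: fun_eq_iff)
      have "(\<Sum>x\<in>X. g x + p * unit_at m x + unit_at l x) = sum g X + p * sum (unit_at m) X + 1"
        using lX by (simp add: sum.distrib sum_distrib_left[symmetric] sum_unit_at)
      then have deg: "(\<Sum>x\<in>X. g x + p * unit_at m x + unit_at l x) = d"
        using g_deg iX m(2) sum_unit_at[of m] by auto
      have sm: "small (\<lambda>x. g x + p * unit_at m x + unit_at l x)"
        by (rule small_cong_supp[OF m(1) _ deg]) (use gX iX lX l m(2) in auto)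
      moreover have "conn \<alpha> (\<lambda>x. (g x + p * unit_at m x) + unit_at m x)
          (\<lambda>x. (g x + p * unit_at m x) + unit_at l x)"
      proof (rule conn_unit_step[OF _ sm _ \<alpha>0 \<alpha>_deg])
        show "small (\<lambda>x. g x + p * unit_at m x + unit_at m x)" using m(1) eq(1) by simp
        show "m \<noteq> l" using m lX by auto
        show "g x + p * unit_at m x + unit_at m x + unit_at l x \<le> \<alpha> x" for x
          using le[of x] l m lX by auto
      qed
      ultimately show ?thesis unfolding eq by blast
    qed
    note si = step[OF small_i insertI1] and sj = step[OF small_j insertI2[OF singletonI]]
    have "{x. ?g x \<noteq> 0} = {x. g x \<noteq> 0}" using l by auto
    then have card_eq: "card {x. ?g x \<noteq> 0} = h" using Suc.prems(5) by (rule ssubst)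
    have "conn \<alpha> (\<lambda>x. ?g x + p * unit_at i x) (\<lambda>x. ?g x + p * unit_at j x)"
    proof (rule Suc.IH[OF conjunct1[OF si] conjunct1[OF sj] _ _ card_eq])
      show "?g x + p * unit_at i x + p * unit_at j x \<le> \<alpha> x" for x
        using le[of x] l lX by auto
    qed (use Suc.prems(3,4) lX in auto)
    from conn_trans[OF conn_trans[OF conjunct2[OF si] this] conn_sym[OF conjunct2[OF sj]]]
    show ?thesis .
  next
    case False
    define \<gamma> where "\<gamma> x = \<alpha> x - (g x + Suc p * unit_at i x + Suc p * unit_at j x)" for x
    have \<alpha>: "\<alpha> x = \<gamma> x + (g x + Suc p * unit_at i x + Suc p * unit_at j x)" for x
      using le[of x] unfolding \<gamma>_def by simp
    have "sum \<alpha> X = sum \<gamma> X + (sum g X + Suc p * sum (unit_at i) X + Suc p * sum (unit_at j) X)"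
      unfolding sum.distrib[symmetric] sum_distrib_left using \<alpha> by simp
    then have \<gamma>_deg: "sum \<gamma> X = 2 * d - Suc p"
      using iX \<alpha>_deg g_deg by (simp add: sum_unit_at)
    \<comment> \<open>Cutting \<open>c\<close> off \<open>\<gamma>\<close> leaves a part of degree
      \<open>d\<close>. That part is a common neighbour of both ends; the third factor is
      \<open>c\<close> times the power of the variable missing from the respective end.\<close>
    then have "d - Suc p \<le> sum \<gamma> X" by simp
    from exists_divisor[OF finX this] obtain c
      where c: "\<And>x. c x \<le> \<gamma> x" "sum c X = d - Suc p" by blast
    let ?S = "{x. g x \<noteq> 0}"
    have "x \<in> X" if "g x \<noteq> 0" for x using gX[of x] that by auto
    then have "?S \<subseteq> X" by auto
    then have cardS: "card (X - ?S) = h + 1"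
      using Suc.prems(5) cardX finX by (subst card_Diff_subset) (auto intro: finite_subset)
    have \<gamma>0: "\<gamma> x = 0" if "x \<notin> X - ?S" for x
      using that \<alpha>[of x] \<alpha>0 gX[of x] False Suc.prems(3,4) iX by fastforce
    have sm: "small f" if "\<forall>x. x \<notin> X - ?S \<longrightarrow> f x = 0" "sum f X = d" for f
    proof -
      have "card {x. f x \<noteq> 0} \<le> card (X - ?S)"
        by (rule card_mono) (use that finX in auto)
      then show ?thesis using that cardS unfolding small_def by auto
    qed
    have c0: "c x = 0" if "x \<notin> X - ?S" for x
      using c(1)[of x] \<gamma>0[OF that] by simp
    have smc: "small (\<lambda>x. c x + Suc p * unit_at m x)" if "m \<in> {i, j}" for m
    proof (rule sm)
      have "(\<Sum>x\<in>X. c x + Suc p * unit_at m x) = sum c X + Suc p * sum (unit_at m) X"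
        unfolding sum.distrib sum_distrib_left ..
      then show "(\<Sum>x\<in>X. c x + Suc p * unit_at m x) = d"
        using c(2) g_deg iX that sum_unit_at[of m] by auto
    qed (use c0 that iX Suc.prems(3,4) in auto)
    have sm\<gamma>: "small (\<lambda>x. \<gamma> x - c x)"
      by (rule sm) (use \<gamma>0 c \<gamma>_deg g_deg sum_subtractf_nat[of X c \<gamma>] in auto)
    have 1: "adj \<alpha> (\<lambda>x. g x + Suc p * unit_at i x) (\<lambda>x. \<gamma> x - c x)"
    proof (rule adjI[OF small_i sm\<gamma> smc[of j] \<alpha>0 \<alpha>_deg])
      show "g x + Suc p * unit_at i x + (\<gamma> x - c x) + (c x + Suc p * unit_at j x) = \<alpha> x" for x
        using c(1)[of x] unfolding \<alpha>[of x] by linarith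
    qed simp
    have 2: "adj \<alpha> (\<lambda>x. g x + Suc p * unit_at j x) (\<lambda>x. \<gamma> x - c x)"
    proof (rule adjI[OF small_j sm\<gamma> smc[of i] \<alpha>0 \<alpha>_deg])
      show "g x + Suc p * unit_at j x + (\<gamma> x - c x) + (c x + Suc p * unit_at i x) = \<alpha> x" for x
        using c(1)[of x] unfolding \<alpha>[of x] by linarith
    qed simp
    show ?thesis by (rule conn_trans[OF adj_conn[OF 1] adj_conn[OF adj_sym[OF 2]]])
  qed
qed

section \<open>Small divisors of monomials of degree at least \<open>2 * d\<close>\<close>

text \<open>In a balanced partition of \<open>\<gamma>\<close> with threshold \<open>d\<close>, each
  side with its share of \<open>l\<close> is one factor, and the two shares add up to
  \<open>\<gamma> l\<close>. Any three variables may start the construction.\<close>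

lemma divisor_split:
  assumes "\<forall>x. x \<notin> X \<longrightarrow> \<gamma> x = 0" "sum \<gamma> X = 2 * d"
  shows "\<exists>a b. small a \<and> small b \<and> (\<forall>x. a x + b x = \<gamma> x)"
proof -
  have "3 \<le> card X" using cardX h_pos by simp
  then obtain Z where "Z \<subseteq> X" "card Z = 3" by (meson obtain_subset_with_card_n)
  then obtain i j k where "i \<in> X" "j \<in> X" "k \<in> X" "i \<noteq> j" "i \<noteq> k" "j \<noteq> k"
    by (auto simp: card_3_iff)
  from exists_balanced[OF _ this, of \<gamma> d] assms(2)
  obtain A l B where bal: "balanced \<gamma> d A l B" by auto
  have P: "X = insert l (A \<union> B)" "l \<notin> A \<union> B" "A \<inter> B = {}" "sum \<gamma> A \<le> d" "sum \<gamma> B \<le> d"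
    using bal unfolding balanced_def by auto
  then have "finite A" "finite B" using finX by auto
  with P have "sum \<gamma> X = \<gamma> l + (sum \<gamma> A + sum \<gamma> B)"
    by (simp add: sum.union_disjoint)
  with assms P have "fill A l \<gamma> x + fill B l \<gamma> x = \<gamma> x" for x
    by (auto simp: fill_def)
  moreover have "small (fill A l \<gamma>)" "small (fill B l \<gamma>)"
    using small_fill[OF bal] small_fill[OF balanced_sym[OF bal]] P by auto
  ultimately show ?thesis by blast
qed

lemma exists_small_divisor:
  assumes "\<forall>x. x \<notin> X \<longrightarrow> \<gamma> x = 0" "2 * d \<le> sum \<gamma> X"
  shows "\<exists>a. small a \<and> (\<forall>x. a x \<le> \<gamma> x)"
proof -
  obtain c where c: "\<forall>x. c x \<le> \<gamma> x" "sum c X = 2 * d"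
    using exists_divisor[OF finX assms(2)] by blast
  then have "\<forall>x. x \<notin> X \<longrightarrow> c x = 0" using assms(1) by (metis le_zero_eq)
  from divisor_split[OF this c(2)] obtain a b where "small a" "\<forall>x. a x + b x = c x" by blast
  with c(1) show ?thesis by (metis le_add1 le_trans)
qed

section \<open>Walking from one small divisor to another\<close>

text \<open>Trading one \<open>x\<^sub>i\<close> for \<open>x\<^sub>j\<close> lowers the distance to
  \<open>b\<close>, here the sum of the truncated differences both ways, but may push the support
  beyond \<open>h + 1\<close>. In that case the full power of \<open>x\<^sub>i\<close> is traded, so
  that \<open>j\<close> replaces \<open>i\<close> in the support.\<close>

lemma exists_closer:
  assumes a: "small a" and b: "small b" and a_le: "\<And>x. a x \<le> \<alpha> x" and b_le: "\<And>x. b x \<le> \<alpha> x"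
    and \<alpha>0: "\<forall>x. x \<notin> X \<longrightarrow> \<alpha> x = 0" and \<alpha>_deg: "sum \<alpha> X = 3 * d"
    and i: "b i < a i" and j: "a j < b j"
    and cases: "a j \<noteq> 0 \<or> card {x. a x \<noteq> 0} \<le> h \<or> b i = 0 \<and> a i \<le> b j"
  shows "\<exists>a'. small a' \<and> (\<forall>x. a' x \<le> \<alpha> x) \<and> conn \<alpha> a a' \<and>
    (\<Sum>x\<in>X. (a' x - b x) + (b x - a' x)) < (\<Sum>x\<in>X. (a x - b x) + (b x - a x))"
proof -
  have ij: "i \<noteq> j" using i j by auto
  have aX: "a x = 0" if "x \<notin> X" for x using a that unfolding small_def by blast
  have bX: "b x = 0" if "x \<notin> X" for x using b that unfolding small_def by blast
  have iX: "i \<in> X" and jX: "j \<in> X" using i j aX[of i] bX[of j] by auto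
  define g where "g p x = a x - p * unit_at i x" for p x
  define a' where "a' p x = g p x + p * unit_at j x" for p x
  have a_eq: "a = (\<lambda>x. g p x + p * unit_at i x)" if "p \<le> a i" for p
    using that unfolding g_def by auto
  have deg: "sum (a' p) X = d" if "p \<le> a i" for p
  proof -
    have "sum (g p) X + p * sum (unit_at i) X = sum a X"
      unfolding sum_distrib_left sum.distrib[symmetric] using a_eq[OF that] by metis
    moreover have "sum (a' p) X = sum (g p) X + p * sum (unit_at j) X"
      unfolding a'_def sum_distrib_left sum.distrib ..
    ultimately show ?thesis using a iX jX unfolding small_def by (simp add: sum_unit_at)
  qed
  have closer: "(\<Sum>x\<in>X. (a' p x - b x) + (b x - a' p x)) < (\<Sum>x\<in>X. (a x - b x) + (b x - a x))"
    if "p \<ge> 1" "p \<le> a i - b i" "p \<le> b j - a j" for p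
  proof (rule sum_strict_mono_ex1[OF finX])
    show "\<forall>x\<in>X. (a' p x - b x) + (b x - a' p x) \<le> (a x - b x) + (b x - a x)"
      using that ij i j unfolding a'_def g_def by auto
    show "\<exists>x\<in>X. (a' p x - b x) + (b x - a' p x) < (a x - b x) + (b x - a x)"
      using that ij i j iX unfolding a'_def g_def by (intro bexI[of _ i]) auto
  qed
  have le: "a' p x \<le> \<alpha> x" if "p \<le> a i - b i" "p \<le> b j - a j" for p x
    using that a_le[of x] b_le[of x] j unfolding a'_def g_def by auto
  have le': "g p x + p * unit_at i x + p * unit_at j x \<le> \<alpha> x"
    if "p \<le> a i - b i" "p \<le> b j - a j" for p x
    using that a_le[of x] b_le[of x] ij i j unfolding g_def by auto
  have a'X: "\<forall>x. x \<notin> X \<longrightarrow> a' p x = 0" for p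
    using aX iX jX unfolding a'_def g_def by auto
  have supp: "{x. a' p x \<noteq> 0} \<subseteq> insert j {x. a x \<noteq> 0}" for p
    unfolding a'_def g_def by (auto split: if_splits)
  have fin: "finite {x. a x \<noteq> 0}" using a finite_supp unfolding small_def by blast
  show ?thesis
  proof (cases "a j \<noteq> 0 \<or> card {x. a x \<noteq> 0} \<le> h")
    case True
    have "card {x. a' 1 x \<noteq> 0} \<le> h + 1"
      using True
    proof
      assume "a j \<noteq> 0"
      then have "card {x. a' 1 x \<noteq> 0} \<le> card {x. a x \<noteq> 0}"
        using supp[of 1] by (intro card_mono fin) auto
      then show ?thesis using a unfolding small_def by simp
    next
      assume "card {x. a x \<noteq> 0} \<le> h"
      then have "card (insert j {x. a x \<noteq> 0}) \<le> h + 1"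
        using fin by (simp add: card_insert_if)
      then show ?thesis using card_mono[OF _ supp[of 1]] fin by simp
    qed
    then have sm: "small (a' 1)" unfolding small_def using a'X deg[of 1] i by auto
    have a1: "a = (\<lambda>x. g 1 x + unit_at i x)" using a_eq[of 1] i by simp
    have a'1: "a' 1 = (\<lambda>x. g 1 x + unit_at j x)" unfolding a'_def by simp
    have "conn \<alpha> (\<lambda>x. g 1 x + unit_at i x) (\<lambda>x. g 1 x + unit_at j x)"
      by (rule conn_unit_step[OF a[unfolded a1] sm[unfolded a'1] ij \<alpha>0 \<alpha>_deg])
        (use le'[of 1] i j in auto)
    then have "conn \<alpha> a (a' 1)" using a1 a'1 by simp
    with sm closer[of 1] le[of 1] i j show ?thesis by (intro exI[of _ "a' 1"]) auto
  next
    case False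
    \<comment> \<open>Now \<open>b i = 0\<close> and \<open>a i \<le> b j\<close>, so trading the
      whole power overshoots \<open>b\<close> neither at \<open>i\<close> nor at
      \<open>j\<close>.\<close>
    define p where "p = a i"
    have p: "1 \<le> p" "p \<le> a i - b i" "p \<le> b j - a j" "p \<le> a i"
      using False cases i unfolding p_def by auto
    have card: "card {x. a x \<noteq> 0} = h + 1" using False a unfolding small_def by simp
    have gs: "{x. g p x \<noteq> 0} = {x. a x \<noteq> 0} - {i}" unfolding g_def p_def by auto
    have cg: "card {x. g p x \<noteq> 0} = h" unfolding gs using card i fin by simp
    have "{x. a' p x \<noteq> 0} \<subseteq> insert j {x. g p x \<noteq> 0}" unfolding a'_def by auto
    then have "card {x. a' p x \<noteq> 0} \<le> card (insert j {x. g p x \<noteq> 0})"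
      using fin gs by (intro card_mono) auto
    also have "\<dots> \<le> h + 1" using cg fin gs by (simp add: card_insert_if)
    finally have sm: "small (a' p)" unfolding small_def using a'X deg[OF p(4)] by auto
    have a1: "a = (\<lambda>x. g p x + p * unit_at i x)" by (rule a_eq[OF p(4)])
    have a'1: "a' p = (\<lambda>x. g p x + p * unit_at j x)" unfolding a'_def by simp
    have "conn \<alpha> (\<lambda>x. g p x + p * unit_at i x) (\<lambda>x. g p x + p * unit_at j x)"
    proof (rule conn_shift[OF a[unfolded a1] sm[unfolded a'1] ij _ _ cg \<alpha>0 \<alpha>_deg le'[OF p(2,3)]])
      show "g p i = 0" unfolding g_def p_def by simp
      show "g p j = 0" using False ij unfolding g_def by simp
    qed
    then have "conn \<alpha> a (a' p)" using a1 a'1 by simp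
    with sm closer[OF p(1-3)] le[OF p(2,3)] show ?thesis by (intro exI[of _ "a' p"]) auto
  qed
qed

lemma conn_small:
  assumes "small a" "small b" "\<And>x. a x \<le> \<alpha> x" "\<And>x. b x \<le> \<alpha> x"
    and \<alpha>0: "\<forall>x. x \<notin> X \<longrightarrow> \<alpha> x = 0" and \<alpha>_deg: "sum \<alpha> X = 3 * d"
  shows "conn \<alpha> a b"
  using assms(1-4)
proof (induction "\<Sum>x\<in>X. (a x - b x) + (b x - a x)" arbitrary: a b rule: less_induct)
  case less
  have off: "a x = b x" if "x \<notin> X" for x
    using less.prems(1,2) that unfolding small_def by auto
  have deg: "sum a X = sum b X" using less.prems(1,2) unfolding small_def by simp
  show ?case
  proof (cases "a = b")
    case False
    have "\<exists>i. b i < a i"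
    proof (rule ccontr)
      assume "\<not> ?thesis"
      then have "a x \<le> b x" for x by (simp add: not_less)
      then have "a x = b x" for x
        using sum_mono_inv[OF deg _ _ finX, of x] off by (cases "x \<in> X") auto
      with False show False by (auto simp: fun_eq_iff)
    qed
    then obtain i where i: "b i < a i" ..
    have "\<exists>j. a j < b j"
    proof (rule ccontr)
      assume "\<not> ?thesis"
      then have "b x \<le> a x" for x by (simp add: not_less)
      then have "b x = a x" for x
        using sum_mono_inv[OF deg[symmetric] _ _ finX, of x] off by (cases "x \<in> X") auto
      with False show False by (auto simp: fun_eq_iff)
    qed
    then obtain j where j: "a j < b j" ..
    \<comment> \<open>If the first alternative fails, then \<open>a j = 0\<close>, and
      \<open>b i \<noteq> 0\<close> or \<open>b j < a i\<close>; either way the second holds. So at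
      least one of the two ends can move towards the other.\<close>
    consider "a j \<noteq> 0 \<or> card {x. a x \<noteq> 0} \<le> h \<or> b i = 0 \<and> a i \<le> b j"
      | "b i \<noteq> 0 \<or> card {x. b x \<noteq> 0} \<le> h \<or> a j = 0 \<and> b j \<le> a i" by linarith
    then show ?thesis
    proof cases
      case 1
      from exists_closer[OF less.prems \<alpha>0 \<alpha>_deg i j 1]
      obtain a' where a': "small a'" "\<And>x. a' x \<le> \<alpha> x" "conn \<alpha> a a'"
        "(\<Sum>x\<in>X. (a' x - b x) + (b x - a' x)) < (\<Sum>x\<in>X. (a x - b x) + (b x - a x))" by blast
      from less.hyps[OF a'(4) a'(1) less.prems(2) a'(2) less.prems(4)] a'(3)
      show ?thesis by (rule conn_trans[rotated])
    next
      case 2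
      from exists_closer[OF less.prems(2,1,4,3) \<alpha>0 \<alpha>_deg j i 2]
      obtain b' where b': "small b'" "\<And>x. b' x \<le> \<alpha> x" "conn \<alpha> b b'"
        "(\<Sum>x\<in>X. (b' x - a x) + (a x - b' x)) < (\<Sum>x\<in>X. (b x - a x) + (a x - b x))" by blast
      have "(\<Sum>x\<in>X. (a x - b' x) + (b' x - a x)) < (\<Sum>x\<in>X. (a x - b x) + (b x - a x))"
        using b'(4) by (simp add: add.commute)
      from less.hyps[OF this less.prems(1) b'(1) less.prems(3) b'(2)] conn_sym[OF b'(3)]
      show ?thesis by (rule conn_trans)
    qed
  qed simp
qed

end

section \<open>Factorizations and quadratic moves\<close>

text \<open>This is the product of a factorization, written additively. Multiplication of exponent
  vectors is convolution and \<open>of_nat k\<close> is the constant \<open>k\<close>, so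
  \<open>of_nat k * m\<close> is \<open>m\<close> scaled by \<open>k\<close>.\<close>

definition total :: "nat monomial monomial \<Rightarrow> nat monomial" where
  "total u = (\<Sum>m\<in>Poly_Mapping.keys u. of_nat (Poly_Mapping.lookup u m) * m)"

abbreviation var :: "nat monomial \<Rightarrow> nat monomial monomial" where
  "var m \<equiv> Poly_Mapping.single m 1"

lemma total_superset:
  assumes "finite F" "Poly_Mapping.keys u \<subseteq> F"
  shows "total u = (\<Sum>m\<in>F. of_nat (Poly_Mapping.lookup u m) * m)"
  unfolding total_def using assms
  by (intro sum.mono_neutral_left) (auto simp: in_keys_iff)

lemma total_add: "total (u + v) = total u + total v"
proof -
  let ?F = "Poly_Mapping.keys u \<union> Poly_Mapping.keys v"
  have "total (u + v) = (\<Sum>m\<in>?F. of_nat (Poly_Mapping.lookup (u + v) m) * m)"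
    by (rule total_superset) (auto simp: keys_exponent_add)
  also have "\<dots> = (\<Sum>m\<in>?F. of_nat (Poly_Mapping.lookup u m) * m) +
      (\<Sum>m\<in>?F. of_nat (Poly_Mapping.lookup v m) * m)"
    by (simp add: lookup_add distrib_right sum.distrib)
  also have "\<dots> = total u + total v"
    by (subst (1 2) total_superset[where F = ?F]) auto
  finally show ?thesis .
qed

lemma total_0 [simp]: "total 0 = 0" and total_var: "total (var m) = m"
  by (simp_all add: total_def)

declare total_var[simp] total_var[unfolded One_nat_def, simp]

lemma single_power: "Poly_Mapping.single m (1 :: 'k::comm_semiring_1) ^ k =
    Poly_Mapping.single (of_nat k * m :: nat monomial) 1"
  by (induction k) (simp_all add: mult_single distrib_right)

lemma subst_monomial_total:
  "subst_monomial u = (Poly_Mapping.single (total u) 1 :: (nat, 'k::field) mpoly)"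
proof -
  have "(\<Prod>m\<in>F. Poly_Mapping.single (f m) 1 :: (nat, 'k) mpoly) =
      Poly_Mapping.single (\<Sum>m\<in>F. f m) 1" for F and f :: "nat monomial \<Rightarrow> nat monomial"
    by (induction F rule: infinite_finite_induct) (simp_all add: mult_single)
  then show ?thesis unfolding subst_monomial_def total_def single_power .
qed

lemma mon_degree_var: "mon_degree (Poly_Mapping.single m 1) = 1"
  by (simp add: mon_degree_def)

declare mon_degree_var[simp] mon_degree_var[unfolded One_nat_def, simp]

lemma mon_degree_0 [simp]: "mon_degree 0 = 0"
  by (simp add: mon_degree_def)

lemma mon_degree_Suc:
  fixes u :: "'x monomial"
  assumes "mon_degree u = Suc k"
  obtains m u' where "u = Poly_Mapping.single m 1 + u'" "mon_degree u' = k"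
    "m \<in> Poly_Mapping.keys u" "Poly_Mapping.keys u' \<subseteq> Poly_Mapping.keys u"
proof -
  have "Poly_Mapping.keys u \<noteq> {}" using assms by (auto simp: mon_degree_def)
  then obtain m where m: "m \<in> Poly_Mapping.keys u" by blast
  define u' where "u' = u - Poly_Mapping.single m 1"
  have u: "u = Poly_Mapping.single m 1 + u'"
    unfolding u'_def by (rule poly_mapping_eqI)
      (use m in \<open>auto simp: lookup_add lookup_minus lookup_single when_def in_keys_iff\<close>)
  then have "mon_degree u = 1 + mon_degree u'" by (metis mon_degree_add mon_degree_var)
  with that[OF u _ m] assms keys_exponent_add[of "Poly_Mapping.single m 1" u'] u show ?thesis
    by auto
qed

lemma mon_degree_eq_0: "mon_degree u = 0 \<Longrightarrow> u = 0"
  by (rule poly_mapping_eqI) (auto simp: mon_degree_def in_keys_iff)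

lemma mon_degree_total:
  assumes "Poly_Mapping.keys u \<subseteq> \<Omega>" "\<And>m. m \<in> \<Omega> \<Longrightarrow> mon_degree m = d"
  shows "mon_degree (total u) = mon_degree u * d"
  using assms(1)
proof (induction "mon_degree u" arbitrary: u)
  case 0
  then show ?case using mon_degree_eq_0[of u] by simp
next
  case (Suc k)
  from mon_degree_Suc[OF Suc.hyps(2)[symmetric]]
  obtain m u' where u: "u = var m + u'" "mon_degree u' = k"
    "m \<in> Poly_Mapping.keys u" "Poly_Mapping.keys u' \<subseteq> Poly_Mapping.keys u" by blast
  then have "mon_degree (total u) = d + k * d"
    using Suc assms(2) by (auto simp: total_add mon_degree_add)
  then show ?case using Suc.hyps(2)[symmetric] by simp
qed

lemma keys_total:
  assumes "\<And>m. m \<in> Poly_Mapping.keys u \<Longrightarrow> Poly_Mapping.keys m \<subseteq> V"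
  shows "Poly_Mapping.keys (total u) \<subseteq> V"
  using assms
proof (induction "mon_degree u" arbitrary: u)
  case 0
  then show ?case using mon_degree_eq_0[of u] by simp
next
  case (Suc k)
  from mon_degree_Suc[OF Suc.hyps(2)[symmetric]]
  obtain m u' where u: "u = var m + u'" "mon_degree u' = k"
    "m \<in> Poly_Mapping.keys u" "Poly_Mapping.keys u' \<subseteq> Poly_Mapping.keys u" by blast
  then have "Poly_Mapping.keys (total u') \<subseteq> V" using Suc by blast
  with u(1) Suc.prems[OF u(3)] show ?case by (simp add: total_add keys_exponent_add)
qed

section \<open>Quadratic moves\<close>

text \<open>As polynomials, \<open>u\<close> and \<open>v\<close> then differ by a quadratic
  binomial of the defining ideal multiplied by the monomial \<open>w\<close>.\<close>

definition quad_step :: "nat monomial set \<Rightarrow> nat monomial monomial \<Rightarrow> nat monomial monomial \<Rightarrow> bool"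
  where "quad_step \<Omega> u v \<longleftrightarrow> (\<exists>a\<in>\<Omega>. \<exists>b\<in>\<Omega>. \<exists>a'\<in>\<Omega>. \<exists>b'\<in>\<Omega>. \<exists>w. a + b = a' + b' \<and>
    Poly_Mapping.keys w \<subseteq> \<Omega> \<and> u = var a + var b + w \<and> v = var a' + var b' + w)"

abbreviation quad_eq :: "nat monomial set \<Rightarrow> nat monomial monomial \<Rightarrow> nat monomial monomial \<Rightarrow> bool"
  where "quad_eq \<Omega> \<equiv> (quad_step \<Omega>)\<^sup>*\<^sup>*"

lemma quad_eq_sym: "quad_eq \<Omega> u v \<Longrightarrow> quad_eq \<Omega> v u"
proof -
  have "symp (quad_step \<Omega>)" unfolding quad_step_def by (rule sympI) metis
  then show "quad_eq \<Omega> u v \<Longrightarrow> quad_eq \<Omega> v u" using symp_rtranclp by (auto dest: sympD)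
qed

lemma quad_eq_trans: "quad_eq \<Omega> u v \<Longrightarrow> quad_eq \<Omega> v w \<Longrightarrow> quad_eq \<Omega> u w"
  by (rule rtranclp_trans)

lemma quad_eq_pair:
  assumes "a \<in> \<Omega>" "b \<in> \<Omega>" "a' \<in> \<Omega>" "b' \<in> \<Omega>" "a + b = a' + b'" "Poly_Mapping.keys w \<subseteq> \<Omega>"
  shows "quad_eq \<Omega> (var a + var b + w) (var a' + var b' + w)"
  by (rule r_into_rtranclp) (use assms in \<open>unfold quad_step_def, blast\<close>)

lemma quad_eq_add:
  assumes "quad_eq \<Omega> u v" "Poly_Mapping.keys w \<subseteq> \<Omega>"
  shows "quad_eq \<Omega> (w + u) (w + v)"
  using assms(1)
proof (induction rule: rtranclp_induct)
  case base
  then show ?case by simp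
next
  case (step v v')
  from step(2) obtain a b a' b' z where *: "a \<in> \<Omega>" "b \<in> \<Omega>" "a' \<in> \<Omega>" "b' \<in> \<Omega>" "a + b = a' + b'"
    "Poly_Mapping.keys z \<subseteq> \<Omega>" "v = var a + var b + z" "v' = var a' + var b' + z"
    unfolding quad_step_def by blast
  have "Poly_Mapping.keys (w + z) \<subseteq> \<Omega>" using * assms(2) by (simp add: keys_exponent_add)
  from quad_eq_pair[OF *(1-5) this] have "quad_eq \<Omega> (w + v) (w + v')"
    unfolding *(7,8) by (simp add: ac_simps)
  with step.IH show ?case by (rule quad_eq_trans)
qed

section \<open>Connecting all factorizations of a monomial\<close>

text \<open>For natural numbers, \<open>(n + 1) div 2 + 1\<close> is the ceiling of
  \<open>(n + 2) / 2\<close>.\<close>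

locale monomial_projection =
  fixes n d :: nat and \<Omega> :: "nat monomial set"
  assumes n_pos: "n \<ge> 1" and d_pos: "d \<ge> 1" and \<Omega>_sub: "\<Omega> \<subseteq> monomials n d"
    and \<Omega>_sup: "{m \<in> monomials n d. card (Poly_Mapping.keys m) \<le> (n + 1) div 2 + 1} \<subseteq> \<Omega>"
begin

text \<open>
  The variables are padded to an odd number \<open>2 * half + 1\<close>; for even \<open>n\<close> there is no extra variable,
  for odd \<open>n\<close> one.
\<close>

definition half :: nat where "half = (n + 1) div 2"

abbreviation X where "X \<equiv> {0..2 * half}"

sublocale odd_support X half d
  by unfold_locales (use n_pos in \<open>auto simp: half_def\<close>)

lemma V_sub: "{0..n} \<subseteq> X" unfolding half_def by auto

lemma mon_degree_X:
  assumes "Poly_Mapping.keys m \<subseteq> {0..n}"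
  shows "mon_degree m = sum (Poly_Mapping.lookup m) X"
  by (rule mon_degree_superset) (use assms V_sub in blast)+

lemma lookup_off_X:
  assumes "Poly_Mapping.keys m \<subseteq> {0..n}"
  shows "\<forall>x. x \<notin> X \<longrightarrow> Poly_Mapping.lookup m x = 0"
  using assms V_sub by (metis in_keys_iff subsetD)

lemma small_lookup_in:
  assumes "small (Poly_Mapping.lookup m)" "Poly_Mapping.keys m \<subseteq> {0..n}"
  shows "m \<in> \<Omega>"
proof -
  have "{x. Poly_Mapping.lookup m x \<noteq> 0} = Poly_Mapping.keys m" by (auto simp: in_keys_iff)
  then have "m \<in> {m \<in> monomials n d. card (Poly_Mapping.keys m) \<le> half + 1}"
    using assms mon_degree_X[OF assms(2)] unfolding small_def monomials_def by simp
  then show ?thesis using \<Omega>_sup unfolding half_def by blast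
qed

lemma exists_lookup:
  fixes \<beta> :: "nat monomial"
  assumes "\<And>x. f x \<le> Poly_Mapping.lookup \<beta> x"
  obtains m where "f = Poly_Mapping.lookup m" "Poly_Mapping.keys m \<subseteq> Poly_Mapping.keys \<beta>"
proof
  have "x \<in> Poly_Mapping.keys \<beta>" if "f x \<noteq> 0" for x
    using assms[of x] that by (auto simp: in_keys_iff)
  then have "finite {x. f x \<noteq> 0}" by (auto intro: finite_subset[OF _ finite_keys[of \<beta>]])
  then show eq: "f = Poly_Mapping.lookup (Abs_poly_mapping f)"
    by (simp add: Abs_poly_mapping_inverse)
  show "Poly_Mapping.keys (Abs_poly_mapping f) \<subseteq> Poly_Mapping.keys \<beta>"
    using assms by (metis eq in_keys_iff le_zero_eq subsetI)
qed

lemma keys_in_\<Omega>: "m \<in> \<Omega> \<Longrightarrow> Poly_Mapping.keys m \<subseteq> {0..n}"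
  and deg_in_\<Omega>: "m \<in> \<Omega> \<Longrightarrow> mon_degree m = d"
  using \<Omega>_sub unfolding monomials_def by auto

text \<open>Divisors of \<open>\<beta>\<close> involve only its variables, so a padding variable of
  \<open>X\<close> cannot enter them.\<close>

lemma monomial_split:
  assumes "Poly_Mapping.keys \<beta> \<subseteq> {0..n}" "mon_degree \<beta> = 2 * d"
  obtains a b where "small (Poly_Mapping.lookup a)" "small (Poly_Mapping.lookup b)"
    "a \<in> \<Omega>" "b \<in> \<Omega>" "a + b = \<beta>"
proof -
  have "sum (Poly_Mapping.lookup \<beta>) X = 2 * d" using assms mon_degree_X by simp
  from divisor_split[OF lookup_off_X[OF assms(1)] this]
  obtain f g where fg: "small f" "small g" "\<And>x. f x + g x = Poly_Mapping.lookup \<beta> x" by blast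
  obtain a where a: "f = Poly_Mapping.lookup a" "Poly_Mapping.keys a \<subseteq> Poly_Mapping.keys \<beta>"
    using exists_lookup[of f \<beta>] fg(3) by (metis le_add1)
  obtain b where b: "g = Poly_Mapping.lookup b" "Poly_Mapping.keys b \<subseteq> Poly_Mapping.keys \<beta>"
    using exists_lookup[of g \<beta>] fg(3) by (metis le_add2)
  have "a + b = \<beta>" by (rule poly_mapping_eqI) (use fg(3) a b in \<open>simp add: lookup_add\<close>)
  moreover have "a \<in> \<Omega>" using small_lookup_in fg(1) a assms(1) by blast
  moreover have "b \<in> \<Omega>" using small_lookup_in fg(2) b assms(1) by blast
  ultimately show ?thesis using that fg a b by blast
qed

lemma monomial_divisor:
  assumes "Poly_Mapping.keys \<beta> \<subseteq> {0..n}" "2 * d \<le> mon_degree \<beta>"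
  obtains a r where "a \<in> \<Omega>" "a + r = \<beta>"
proof -
  have "2 * d \<le> sum (Poly_Mapping.lookup \<beta>) X" using assms mon_degree_X by simp
  from exists_small_divisor[OF lookup_off_X[OF assms(1)] this]
  obtain f where f: "small f" "\<And>x. f x \<le> Poly_Mapping.lookup \<beta> x" by blast
  obtain a where a: "f = Poly_Mapping.lookup a" "Poly_Mapping.keys a \<subseteq> Poly_Mapping.keys \<beta>"
    using exists_lookup[of f \<beta>] f(2) by metis
  have "a + (\<beta> - a) = \<beta>"
    by (rule poly_mapping_eqI) (use f(2) a in \<open>simp add: lookup_add lookup_minus\<close>)
  moreover have "a \<in> \<Omega>" using small_lookup_in f(1) a assms(1) by blast
  ultimately show ?thesis using that by blast
qed

text \<open>Divisors are split off until degree \<open>2 * d\<close> remains. There the balanced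
  split is needed, because the cofactor of a single divisor might lie outside
  \<open>\<Omega>\<close>.\<close>

lemma exists_factorization:
  assumes "Poly_Mapping.keys \<beta> \<subseteq> {0..n}" "mon_degree \<beta> = (k + 2) * d"
  shows "\<exists>u. Poly_Mapping.keys u \<subseteq> \<Omega> \<and> total u = \<beta>"
  using assms
proof (induction k arbitrary: \<beta>)
  case 0
  then have "mon_degree \<beta> = 2 * d" by simp
  from monomial_split[OF 0(1) this] obtain a b where "a \<in> \<Omega>" "b \<in> \<Omega>" "a + b = \<beta>" .
  then show ?case
    by (intro exI[of _ "var a + var b"]) (auto simp: total_add keys_exponent_add)
next
  case (Suc k)
  have "2 * d \<le> mon_degree \<beta>" using Suc.prems(2) by simp
  from monomial_divisor[OF Suc.prems(1) this] obtain a r where a: "a \<in> \<Omega>" "a + r = \<beta>" .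
  have "Poly_Mapping.keys r \<subseteq> {0..n}" using a(2) Suc.prems(1) keys_exponent_add[of a r] by auto
  moreover have "mon_degree r = (k + 2) * d"
    using a Suc.prems(2) deg_in_\<Omega>[of a] mon_degree_add[of a r] by auto
  ultimately obtain u where "Poly_Mapping.keys u \<subseteq> \<Omega>" "total u = r" using Suc.IH by blast
  then show ?case using a
    by (intro exI[of _ "var a + u"]) (auto simp: total_add keys_exponent_add)
qed

lemma quad_eq_triple_shared:
  assumes "{a, b, c, b', c'} \<subseteq> \<Omega>" "a + b + c = a + b' + c'"
  shows "quad_eq \<Omega> (var a + var b + var c) (var a + var b' + var c')"
proof -
  have "b + c = b' + c'" using assms(2) by (simp add: add.assoc)
  from quad_eq_pair[OF _ _ _ _ this, of \<Omega> "var a"] assms(1) show ?thesis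
    by (simp add: ac_simps)
qed

text \<open>Each edge carries a full factorization, and those at consecutive edges share the vertex
  in between, so that passing from one to the next is a single move.\<close>

lemma conn_imp_quad_eq:
  assumes \<beta>: "Poly_Mapping.keys \<beta> \<subseteq> {0..n}"
    and conn: "conn (Poly_Mapping.lookup \<beta>) f (Poly_Mapping.lookup b)"
    and "f = Poly_Mapping.lookup a"
    and "{a, b, c, c', e, e'} \<subseteq> \<Omega>" "a + c + c' = \<beta>" "b + e + e' = \<beta>"
  shows "quad_eq \<Omega> (var a + var c + var c') (var b + var e + var e')"
  using conn assms(3-6)
proof (induction arbitrary: a c c' rule: converse_rtranclp_induct)
  case base
  then have "a = b" by (simp add: poly_mapping_eqI)
  with base show ?case using quad_eq_triple_shared[of b c c' e e'] by simp
next
  case (step f g)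
  from step(1) obtain r where r: "small f" "small g" "small r"
    "\<And>x. f x + g x + r x = Poly_Mapping.lookup \<beta> x" unfolding adj_def by blast
  have le: "g x \<le> Poly_Mapping.lookup \<beta> x" "r x \<le> Poly_Mapping.lookup \<beta> x" for x
    using r(4)[of x] by auto
  obtain q where q: "g = Poly_Mapping.lookup q" "Poly_Mapping.keys q \<subseteq> Poly_Mapping.keys \<beta>"
    using exists_lookup[OF le(1)] .
  obtain s where s: "r = Poly_Mapping.lookup s" "Poly_Mapping.keys s \<subseteq> Poly_Mapping.keys \<beta>"
    using exists_lookup[OF le(2)] .
  have \<Omega>: "q \<in> \<Omega>" "s \<in> \<Omega>" using small_lookup_in r(2,3) q s \<beta> by blast+
  have sum: "a + q + s = \<beta>"
    by (rule poly_mapping_eqI) (use r(4) q s step.prems(1) in \<open>simp add: lookup_add\<close>)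
  have "quad_eq \<Omega> (var a + var c + var c') (var a + var q + var s)"
    by (rule quad_eq_triple_shared) (use \<Omega> step.prems sum in auto)
  \<comment> \<open>The same factorization is now read from the other end \<open>q\<close> of the
    edge, with \<open>a\<close> and \<open>s\<close> as its cofactors.\<close>
  moreover have "quad_eq \<Omega> (var q + var a + var s) (var b + var e + var e')"
    by (rule step.IH[OF q(1)]) (use \<Omega> step.prems sum in \<open>auto simp: ac_simps\<close>)
  ultimately show ?case unfolding add.commute[of "var q" "var a"] by (rule quad_eq_trans)
qed

lemma quad_eq_triple:
  assumes \<Omega>: "{a, b, c, a', b', c'} \<subseteq> \<Omega>" and eq: "a + b + c = a' + b' + c'"
  shows "quad_eq \<Omega> (var a + var b + var c) (var a' + var b' + var c')"
proof -
  let ?\<beta> = "a + b + c"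
  \<comment> \<open>Only the factor at which the path starts or ends has to be small;
    \<open>z\<close> may be any element of \<open>\<Omega>\<close>.\<close>
  have reduce: "\<exists>p q. small (Poly_Mapping.lookup p) \<and> p \<in> \<Omega> \<and> q \<in> \<Omega> \<and> p + q + z = x + y + z \<and>
      quad_eq \<Omega> (var x + var y + var z) (var p + var q + var z)"
    if xyz: "x \<in> \<Omega>" "y \<in> \<Omega>" "z \<in> \<Omega>" for x y z
  proof -
    have "Poly_Mapping.keys (x + y) \<subseteq> {0..n}" "mon_degree (x + y) = 2 * d"
      using xyz keys_in_\<Omega> deg_in_\<Omega> by (simp_all add: keys_exponent_add mon_degree_add)
    from monomial_split[OF this] obtain p q
      where "small (Poly_Mapping.lookup p)" "p \<in> \<Omega>" "q \<in> \<Omega>" "p + q = x + y" .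
    then show ?thesis
      using quad_eq_pair[of x \<Omega> y p q "var z"] xyz by (intro exI[of _ p] exI[of _ q]) auto
  qed
  obtain p q where p: "small (Poly_Mapping.lookup p)" "p \<in> \<Omega>" "q \<in> \<Omega>" "p + q + c = ?\<beta>"
    "quad_eq \<Omega> (var a + var b + var c) (var p + var q + var c)"
    using reduce[of a b c] \<Omega> by auto
  obtain p' q' where p': "small (Poly_Mapping.lookup p')" "p' \<in> \<Omega>" "q' \<in> \<Omega>" "p' + q' + c' = ?\<beta>"
    "quad_eq \<Omega> (var a' + var b' + var c') (var p' + var q' + var c')"
    using reduce[of a' b' c'] \<Omega> eq by auto
  have \<beta>: "Poly_Mapping.keys ?\<beta> \<subseteq> {0..n}" using \<Omega> keys_in_\<Omega> by (auto simp: keys_exponent_add)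
  have deg: "sum (Poly_Mapping.lookup ?\<beta>) X = 3 * d"
    using \<Omega> deg_in_\<Omega> mon_degree_X[OF \<beta>] by (auto simp: mon_degree_add)
  have le: "Poly_Mapping.lookup p x \<le> Poly_Mapping.lookup ?\<beta> x"
    "Poly_Mapping.lookup p' x \<le> Poly_Mapping.lookup ?\<beta> x" for x
    unfolding p(4)[symmetric] by (simp add: lookup_add)
      (unfold p(4) p'(4)[symmetric], simp add: lookup_add)
  have "conn (Poly_Mapping.lookup ?\<beta>) (Poly_Mapping.lookup p) (Poly_Mapping.lookup p')"
    by (rule conn_small[OF p(1) p'(1) le lookup_off_X[OF \<beta>] deg])
  from conn_imp_quad_eq[OF \<beta> this refl, of q c q' c'] p p' \<Omega>
  have "quad_eq \<Omega> (var p + var q + var c) (var p' + var q' + var c')" by auto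
  with p(5) quad_eq_sym[OF p'(5)] show ?thesis by (blast intro: quad_eq_trans)
qed

lemma quad_eq_of_total:
  assumes "Poly_Mapping.keys u \<subseteq> \<Omega>" "Poly_Mapping.keys v \<subseteq> \<Omega>" "total u = total v"
  shows "quad_eq \<Omega> u v"
  using assms
proof (induction "mon_degree u" arbitrary: u v rule: less_induct)
  case less
  note deg_total = mon_degree_total[OF _ deg_in_\<Omega>]
  define k where "k = mon_degree u"
  have ku: "mon_degree u = k" unfolding k_def ..
  have kv: "mon_degree v = k"
    using deg_total[OF less.prems(1)] deg_total[OF less.prems(2)] less.prems(3) d_pos ku by auto
  show ?case
  proof (cases k)
    case 0
    then show ?thesis using mon_degree_eq_0 ku kv by auto
  next
    case (Suc k1)
    obtain a u' where u: "u = var a + u'" "mon_degree u' = k1" "a \<in> \<Omega>" "Poly_Mapping.keys u' \<subseteq> \<Omega>"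
      using mon_degree_Suc[of u k1] ku Suc less.prems(1) by (metis subset_trans subsetD)
    obtain b v' where v: "v = var b + v'" "mon_degree v' = k1" "b \<in> \<Omega>" "Poly_Mapping.keys v' \<subseteq> \<Omega>"
      using mon_degree_Suc[of v k1] kv Suc less.prems(2) by (metis subset_trans subsetD)
    have tot: "a + total u' = b + total v'" using less.prems(3) u(1) v(1) by (simp add: total_add)
    show ?thesis
    proof (cases k1)
      case 0
      then have "u' = 0" "v' = 0" using u v mon_degree_eq_0 by auto
      with tot u v show ?thesis by simp
    next
      case (Suc k2)
      obtain a2 u2 where u2: "u' = var a2 + u2" "mon_degree u2 = k2" "a2 \<in> \<Omega>"
        "Poly_Mapping.keys u2 \<subseteq> \<Omega>"
        using mon_degree_Suc[of u' k2] u Suc by (metis subset_trans subsetD)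
      obtain b2 v2 where v2: "v' = var b2 + v2" "mon_degree v2 = k2" "b2 \<in> \<Omega>"
        "Poly_Mapping.keys v2 \<subseteq> \<Omega>"
        using mon_degree_Suc[of v' k2] v Suc by (metis subset_trans subsetD)
      show ?thesis
      proof (cases k2)
        case 0
        then have "u2 = 0" "v2 = 0" using u2 v2 mon_degree_eq_0 by auto
        with tot u v u2 v2 quad_eq_pair[of a \<Omega> a2 b b2 0] show ?thesis by simp
      next
        case (Suc k3)
        obtain a3 u3 where u3: "u2 = var a3 + u3" "mon_degree u3 = k3" "a3 \<in> \<Omega>"
          using mon_degree_Suc[of u2 k3] u2 Suc by (metis subsetD)
        obtain b3 v3 where v3: "v2 = var b3 + v3" "mon_degree v3 = k3" "b3 \<in> \<Omega>"
          using mon_degree_Suc[of v2 k3] v2 Suc by (metis subsetD)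
        show ?thesis
        proof (cases k3)
          case 0
          then have "u3 = 0" "v3 = 0" using u3 v3 mon_degree_eq_0 by auto
          with tot u v u2 v2 u3 v3 quad_eq_triple[of a a2 a3 b b2 b3] show ?thesis
            by (simp add: total_add add.assoc)
        next
          case (Suc k4)
          let ?\<beta> = "total u"
          have k: "k = k4 + 4" "k1 = k4 + 3"
            using \<open>k = Suc k1\<close> \<open>k1 = Suc k2\<close> \<open>k2 = Suc k3\<close> Suc by auto
          have \<beta>a: "?\<beta> = a + total u'" and \<beta>b: "?\<beta> = b + total v'"
            using u(1) tot by (simp_all add: total_add)
          have \<beta>: "Poly_Mapping.keys ?\<beta> \<subseteq> {0..n}"
            by (rule keys_total) (use less.prems(1) keys_in_\<Omega> in blast)
          have \<beta>_deg: "mon_degree ?\<beta> = (k4 + 4) * d"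
            using deg_total[OF less.prems(1)] ku k by simp
          \<comment> \<open>With truncated subtraction, \<open>a + (b - a)\<close> is the least
            common multiple of \<open>a\<close> and \<open>b\<close>; its degree is at most
            \<open>2 * d\<close>, out of at least \<open>4 * d\<close>.\<close>
          define \<gamma> where "\<gamma> = ?\<beta> - (a + (b - a))"
          have la: "Poly_Mapping.lookup a x \<le> Poly_Mapping.lookup ?\<beta> x" for x
            unfolding \<beta>a by (simp add: lookup_add)
          have lb: "Poly_Mapping.lookup b x \<le> Poly_Mapping.lookup ?\<beta> x" for x
            unfolding \<beta>b by (simp add: lookup_add)
          have \<gamma>: "?\<beta> = \<gamma> + (a + (b - a))"
            unfolding \<gamma>_def
          proof (rule poly_mapping_eqI)
            fix x show "Poly_Mapping.lookup ?\<beta> x =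
                Poly_Mapping.lookup (?\<beta> - (a + (b - a)) + (a + (b - a))) x"
              using la[of x] lb[of x] by (simp add: lookup_add lookup_minus)
          qed
          have max_b: "a + (b - a) = b + (a - b)"
            by (rule poly_mapping_eqI) (simp add: lookup_add lookup_minus)
          have "b = (b - a) + (b - (b - a))"
            by (rule poly_mapping_eqI) (simp add: lookup_add lookup_minus)
          then have "mon_degree (b - a) \<le> d"
            using deg_in_\<Omega>[OF v(3)] mon_degree_add by (metis le_add1)
          moreover have "mon_degree ?\<beta> = mon_degree \<gamma> + (d + mon_degree (b - a))"
            using \<gamma> mon_degree_add deg_in_\<Omega>[OF u(3)] by metis
          ultimately have "2 * d \<le> mon_degree \<gamma>" using \<beta>_deg by (simp add: algebra_simps)
          moreover have "Poly_Mapping.keys \<gamma> \<subseteq> {0..n}"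
            using \<beta> \<gamma> keys_exponent_add[of \<gamma> "a + (b - a)"] by auto
          ultimately obtain c r where c: "c \<in> \<Omega>" "c + r = \<gamma>" using monomial_divisor by metis
          \<comment> \<open>These are the cofactors of \<open>a + c\<close> and \<open>b + c\<close>
            in \<open>total u\<close>.\<close>
          define ra rb where "ra = r + (b - a)" and "rb = r + (a - b)"
          have \<beta>c: "?\<beta> = c + r + (a + (b - a))" using \<gamma> c(2) by simp
          then have ra: "?\<beta> = a + c + ra" unfolding ra_def by (simp add: ac_simps)
          from \<beta>c have rb: "?\<beta> = b + c + rb" unfolding rb_def max_b by (simp add: ac_simps)
          have fact: "\<exists>w. Poly_Mapping.keys w \<subseteq> \<Omega> \<and> total w = s \<and> mon_degree w = k4 + 2"
            if s: "?\<beta> = x + c + s" "x \<in> \<Omega>" for s x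
          proof -
            have "Poly_Mapping.keys s \<subseteq> {0..n}"
              using \<beta> s(1) keys_exponent_add[of "x + c" s] by auto
            moreover have deg: "mon_degree s = (k4 + 2) * d"
              using \<beta>_deg s c(1) deg_in_\<Omega> by (auto simp: mon_degree_add algebra_simps)
            ultimately obtain w where w: "Poly_Mapping.keys w \<subseteq> \<Omega>" "total w = s"
              using exists_factorization by blast
            then have "mon_degree w * d = (k4 + 2) * d" using deg_total[OF w(1)] deg by simp
            then have "mon_degree w = k4 + 2 \<or> d = 0" by (rule mult_cancel2[THEN iffD1])
            then have "mon_degree w = k4 + 2" using d_pos by linarith
            with w show ?thesis by (intro exI[of _ w]) simp
          qed
          obtain wa where wa: "Poly_Mapping.keys wa \<subseteq> \<Omega>" "total wa = ra" "mon_degree wa = k4 + 2"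
            using fact[OF ra u(3)] by blast
          obtain wb where wb: "Poly_Mapping.keys wb \<subseteq> \<Omega>" "total wb = rb" "mon_degree wb = k4 + 2"
            using fact[OF rb v(3)] by blast
          have keys: "Poly_Mapping.keys (var x + w) \<subseteq> \<Omega>"
            if "x \<in> \<Omega>" "Poly_Mapping.keys w \<subseteq> \<Omega>" for x w
            using that by (simp add: keys_exponent_add)
          \<comment> \<open>The chain runs from \<open>u\<close> through
            \<open>var a + (var c + wa)\<close> and \<open>var b + (var c + wb)\<close> to
            \<open>v\<close>. Neighbours share first \<open>a\<close>, then \<open>c\<close>, then
            \<open>b\<close>, and each link is the induction hypothesis with one factor
            fewer.\<close>
          have "quad_eq \<Omega> u' (var c + wa)"
          proof (rule less.hyps)
            show "total u' = total (var c + wa)"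
              using \<beta>a ra wa(2) by (simp add: total_add add.assoc)
          qed (use u k ku keys c wa in auto)
          from quad_eq_add[OF this, of "var a"]
          have 1: "quad_eq \<Omega> u (var a + (var c + wa))" using u by simp
          have "quad_eq \<Omega> v' (var c + wb)"
          proof (rule less.hyps)
            show "total v' = total (var c + wb)"
              using \<beta>b rb wb(2) by (simp add: total_add add.assoc)
          qed (use v k ku keys c wb in auto)
          from quad_eq_add[OF this, of "var b"]
          have 2: "quad_eq \<Omega> v (var b + (var c + wb))" using v by simp
          have "quad_eq \<Omega> (var a + wa) (var b + wb)"
          proof (rule less.hyps)
            have "c + (a + ra) = c + (b + rb)" using ra rb by (simp add: ac_simps)
            then show "total (var a + wa) = total (var b + wb)"
              using wa wb by (simp add: total_add)
          qed (use u v k ku keys wa wb in \<open>auto simp: mon_degree_add\<close>)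
          from quad_eq_add[OF this, of "var c"] c
          have 3: "quad_eq \<Omega> (var a + (var c + wa)) (var b + (var c + wb))"
            by (simp add: ac_simps)
          from quad_eq_trans[OF quad_eq_trans[OF 1 3] quad_eq_sym[OF 2]] show ?thesis .
        qed
      qed
    qed
  qed
qed

end

section \<open>The defining ideal\<close>

lemma rho_total:
  "\<rho> p = (\<Sum>u\<in>Poly_Mapping.keys p. Poly_Mapping.single (total u) (Poly_Mapping.lookup p u))"
  by (subst rho_superset[OF finite_keys subset_refl]) (simp add: subst_monomial_total mult_single)

text \<open>The difference telescopes along the chain of moves, and each move contributes a multiple
  of a quadratic binomial killed by \<open>\<rho>\<close>.\<close>

lemma single_minus_single_in_ideal:
  fixes J :: "(nat monomial, 'k::field) mpoly set"
  assumes J: "ideal J (poly_ring \<Omega>)"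
    and quadrics: "\<And>g :: (nat monomial, 'k) mpoly. g \<in> carrier (poly_ring \<Omega>) \<Longrightarrow>
      homogeneous 2 g \<Longrightarrow> \<rho> g = 0 \<Longrightarrow> g \<in> J"
    and "quad_eq \<Omega> u v"
  shows "Poly_Mapping.single u c - Poly_Mapping.single v c \<in> J"
  using assms(3)
proof (induction rule: rtranclp_induct)
  case base
  then show ?case using additive_subgroup.zero_closed[OF ideal.axioms(1)[OF J]] by simp
next
  case (step v w)
  from step(2) obtain a b a' b' z where *: "a \<in> \<Omega>" "b \<in> \<Omega>" "a' \<in> \<Omega>" "b' \<in> \<Omega>" "a + b = a' + b'"
    "Poly_Mapping.keys z \<subseteq> \<Omega>" "v = var a + var b + z" "w = var a' + var b' + z"
    unfolding quad_step_def by blast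
  let ?g = "Poly_Mapping.single (var a + var b) (1 :: 'k) - Poly_Mapping.single (var a' + var b') 1"
  have keys_g: "Poly_Mapping.keys ?g \<subseteq> {var a + var b, var a' + var b'}"
    using keys_diff[of "Poly_Mapping.single (var a + var b) (1 :: 'k)"] by fastforce
  have "?g \<in> J"
  proof (rule quadrics)
    show "?g \<in> carrier (poly_ring \<Omega>)"
      using keys_g * by (fastforce simp: keys_exponent_add)
    show "homogeneous 2 ?g"
      using keys_g unfolding homogeneous_def by (fastforce simp: mon_degree_add)
    have "\<rho> (?g + Poly_Mapping.single (var a' + var b') 1) =
        \<rho> (Poly_Mapping.single (var a' + var b') 1)"
      unfolding diff_add_cancel using *(5) by (simp add: rho_single subst_monomial_total total_add)
    then show "\<rho> ?g = 0" unfolding rho_add by simp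
  qed
  moreover have "Poly_Mapping.single z c \<in> carrier (poly_ring \<Omega>)" using * by simp
  ultimately have "?g * Poly_Mapping.single z c \<in> J" using ideal.I_r_closed[OF J] by fastforce
  moreover have "?g * Poly_Mapping.single z c = Poly_Mapping.single v c - Poly_Mapping.single w c"
    by (simp add: left_diff_distrib mult_single *(7,8))
  ultimately have "Poly_Mapping.single u c - Poly_Mapping.single v c +
      (Poly_Mapping.single v c - Poly_Mapping.single w c) \<in> J"
    using additive_subgroup.a_closed[OF ideal.axioms(1)[OF J]] step.IH by fastforce
  then show ?case by simp
qed

text \<open>Modulo the quadrics, each monomial may be replaced by a fixed representative of its
  fibre under \<open>total\<close>. An element of the kernel then collapses to zero, because its
  coefficients sum to zero over every fibre.\<close>

lemma (in monomial_projection) generated_by_quadrics_defining_ideal: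
  "generated_by_quadrics \<Omega> (defining_ideal n \<Omega> :: (nat monomial, 'k::field) mpoly set)"
proof -
  let ?S = "poly_ring \<Omega> :: (nat monomial, 'k) mpoly ring"
  let ?I = "defining_ideal n \<Omega> :: (nat monomial, 'k) mpoly set"
  interpret S: cring ?S by (rule poly_ring_cring)
  interpret R: cring "poly_ring {0..n} :: (nat, 'k) mpoly ring" by (rule poly_ring_cring)
  interpret hom: ring_hom_ring ?S "poly_ring {0..n} :: (nat, 'k) mpoly ring" \<rho>
    by (rule ring_hom_ringI2[OF S.ring_axioms R.ring_axioms rho_ring_hom[OF \<Omega>_sub]])
  have I: "?I = {p \<in> carrier ?S. \<rho> p = 0}"
    unfolding defining_ideal_def a_kernel_def' by simp
  define G where "G = {g \<in> carrier ?S. homogeneous 2 g \<and> \<rho> g = 0}"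
  let ?J = "Idl\<^bsub>?S\<^esub> G"
  have GS: "G \<subseteq> carrier ?S" unfolding G_def by blast
  have J: "ideal ?J ?S" by (rule S.genideal_ideal[OF GS])
  have GJ: "G \<subseteq> ?J" by (rule S.genideal_self[OF GS])
  have sub: "?J \<subseteq> ?I"
  proof (rule S.genideal_minimal)
    show "ideal ?I ?S" unfolding defining_ideal_def by (rule hom.kernel_is_ideal)
    show "G \<subseteq> ?I" unfolding I G_def by blast
  qed
  have "p \<in> ?J" if "p \<in> ?I" for p
  proof -
    have p: "\<And>u. u \<in> Poly_Mapping.keys p \<Longrightarrow> Poly_Mapping.keys u \<subseteq> \<Omega>" "\<rho> p = 0"
      using that unfolding I by auto
    \<comment> \<open>The choice is used only at values \<open>total u\<close> with \<open>u\<close>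
      a monomial of \<open>p\<close>, where \<open>u\<close> itself is a witness.\<close>
    define rep where "rep \<beta> = (SOME u. Poly_Mapping.keys u \<subseteq> \<Omega> \<and> total u = \<beta>)" for \<beta>
    have rep: "Poly_Mapping.keys (rep (total u)) \<subseteq> \<Omega> \<and> total (rep (total u)) = total u"
      if "u \<in> Poly_Mapping.keys p" for u
      unfolding rep_def by (rule someI[of _ u]) (use p(1)[OF that] in simp)
    let ?c = "Poly_Mapping.lookup p" and ?K = "Poly_Mapping.keys p"
    have diff: "Poly_Mapping.single u (?c u) - Poly_Mapping.single (rep (total u)) (?c u) \<in> ?J"
      if "u \<in> ?K" for u
    proof (rule single_minus_single_in_ideal[OF J])
      show "quad_eq \<Omega> u (rep (total u))"
        using quad_eq_of_total[of u "rep (total u)"] p(1)[OF that] rep[OF that] by simp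
    qed (use GJ in \<open>auto simp: G_def\<close>)
    have J0: "0 \<in> ?J" using additive_subgroup.zero_closed[OF ideal.axioms(1)[OF J]] by simp
    have Jadd: "x + y \<in> ?J" if "x \<in> ?J" "y \<in> ?J" for x y
      using additive_subgroup.a_closed[OF ideal.axioms(1)[OF J] that] by simp
    have Jsum: "(\<Sum>u\<in>F. f u) \<in> ?J" if "\<And>u. u \<in> F \<Longrightarrow> f u \<in> ?J"
      for f and F :: "nat monomial monomial set"
      using that by (induction F rule: infinite_finite_induct) (auto simp: J0 Jadd)
    have single_sum: "Poly_Mapping.single k (sum f F) = (\<Sum>u\<in>F. Poly_Mapping.single k (f u))"
      for k :: "nat monomial monomial" and f :: "nat monomial monomial \<Rightarrow> 'k" and F
      by (induction F rule: infinite_finite_induct) (simp_all add: single_add)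
    \<comment> \<open>The sum over a fibre is the coefficient of \<open>\<beta>\<close> in
      \<open>\<rho> p\<close>.\<close>
    have coeff: "(\<Sum>u | u \<in> ?K \<and> total u = \<beta>. ?c u) = 0" for \<beta>
    proof -
      have "Poly_Mapping.lookup (\<rho> p) \<beta> = (\<Sum>u\<in>?K. if total u = \<beta> then ?c u else 0)"
        unfolding rho_total by (simp add: lookup_sum lookup_single when_def)
      then show ?thesis using p(2) by (simp add: sum.inter_filter)
    qed
    have "(\<Sum>u\<in>?K. Poly_Mapping.single (rep (total u)) (?c u)) =
        (\<Sum>\<beta>\<in>total ` ?K. \<Sum>u | u \<in> ?K \<and> total u = \<beta>. Poly_Mapping.single (rep (total u)) (?c u))"
      by (rule sum.image_gen) simp
    also have "\<dots> = (\<Sum>\<beta>\<in>total ` ?K. Poly_Mapping.single (rep \<beta>) (\<Sum>u | u \<in> ?K \<and> total u = \<beta>. ?c u))"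
      unfolding single_sum by (intro sum.cong) auto
    also have "\<dots> = 0" unfolding coeff by simp
    finally have "(\<Sum>u\<in>?K. Poly_Mapping.single u (?c u) - Poly_Mapping.single (rep (total u)) (?c u)) = p"
      by (simp add: sum_subtractf mpoly_sum_single[symmetric])
    moreover have "(\<Sum>u\<in>?K. Poly_Mapping.single u (?c u) - Poly_Mapping.single (rep (total u)) (?c u)) \<in> ?J"
      by (intro Jsum diff)
    ultimately show ?thesis by simp
  qed
  with sub have "?I = ?J" by blast
  then show ?thesis
    unfolding generated_by_quadrics_def using GS by (intro exI[of _ G]) (auto simp: G_def)
qed

theorem theorem3p10:
  fixes n d :: nat and \<Omega> :: "nat monomial set"
  assumes "n \<ge> 2" and "d \<ge> 2"
    and "\<Omega> \<subseteq> monomials n d"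
    and "{m \<in> monomials n d. int (card (Poly_Mapping.keys m)) \<le> \<lceil>(real n + 2) / 2\<rceil>} \<subseteq> \<Omega>"
  shows "quadratic_algebra n d (monomial_algebra n \<Omega> :: (nat, 'k::field) mpoly set) \<and>
    (\<forall>s::nat. int s \<ge> \<lceil>(real n + 2) / 2\<rceil> \<longrightarrow>
      quadratic_algebra n d (PV n d s :: (nat, 'k) mpoly set))"
proof -
  have ceil: "\<lceil>(real n + 2) / 2\<rceil> = int ((n + 1) div 2 + 1)"
  proof (rule ceiling_unique)
    have "2 * ((n + 1) div 2) \<le> n + 1" "n \<le> 2 * ((n + 1) div 2)" by auto
    then have "2 * real ((n + 1) div 2) \<le> real n + 1" "real n \<le> 2 * real ((n + 1) div 2)"
      by linarith+
    then show "of_int (int ((n + 1) div 2 + 1)) - 1 < (real n + 2) / 2"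
      "(real n + 2) / 2 \<le> of_int (int ((n + 1) div 2 + 1))" by auto
  qed
  \<comment> \<open>A general \<open>\<Omega>'\<close> covers both \<open>\<Omega>\<close> and the
    generators of the pinched Veronese algebras.\<close>
  have quadratic: "quadratic_algebra n d (monomial_algebra n \<Omega>' :: (nat, 'k) mpoly set)"
    if "\<Omega>' \<subseteq> monomials n d"
      "{m \<in> monomials n d. card (Poly_Mapping.keys m) \<le> (n + 1) div 2 + 1} \<subseteq> \<Omega>'" for \<Omega>'
  proof -
    interpret monomial_projection n d \<Omega>' by unfold_locales (use assms that in auto)
    show ?thesis
      unfolding quadratic_algebra_def using generated_by_quadrics_defining_ideal that(1) by blast
  qed
  show ?thesis
    unfolding PV_def ceil
    by (intro conjI allI impI quadratic) (use assms(3,4) ceil in auto)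
qed

end
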